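(* Let $F\in\mathbb{C}[x_0,\dots,x_n]_d$ be a homogeneous polynomial of degree $d$ admitting a rank-1 decomposition of length $h$, and let $H_{\partial,s}$ be the linear span of its partial derivatives of order $s$ in $\mathbb{P}(\mathbb{C}[x_0,\dots,x_n]_{d-s})$. Assume that: - $(n,d,h,s)\in\{(1,2h-1,h,h-2),\ (2,5,7,2),\ (3,3,5,1)\}$; - $H_{\partial,s}$ has (projective) dimension $\binom{n+s}{n}-1$; - $H_{\partial,s}\cap V^n_{d-s}$ is empty. Then $F$ is $h$-identifiable.
   Context: A rank-1 decomposition of $F\in\mathbb{C}[x_0,\dots,x_n]_d$ of length $h$ is an expression $F=\lambda_1L_1^d+\cdots+\lambda_hL_h^d$ with $\lambda_i\in\mathbb{C}^*$, $L_i$ linear forms, and $L_1^d,\dots,L_h^d$ linearly independent. $F$ is $h$-identifiable if it admits such a decomposition of length $h$ and it is unique up to permutation and scaling of the factors. $V_{e}^n\subset\mathbb{P}(\mathbb{C}[x_0,\dots,x_n]_{e})$ is the Veronese variety of $e$-th powers of linear forms. In the first case of the list, $h$ is any integer for which the order $s=h-2$ is nonnegative. *)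

theory Defs
  imports Complex_Main "HOL-Library.Poly_Mapping" "HOL-Combinatorics.Permutations"
begin

text \<open>
  Polynomials over the complex numbers in variables indexed by natural numbers: a monomial is a
  finitely supported exponent vector, a polynomial a finitely supported family of coefficients.
  Multiplication is the convolution product of \<^theory>\<open>HOL-Library.Poly_Mapping\<close>.
\<close>

type_synonym monom = "nat \<Rightarrow>\<^sub>0 nat"
type_synonym mpoly = "monom \<Rightarrow>\<^sub>0 complex"

definition mdeg :: "monom \<Rightarrow> nat" where
  "mdeg m = (\<Sum>i\<in>Poly_Mapping.keys m. Poly_Mapping.lookup m i)"

text \<open>The space of forms of degree \<open>d\<close> in \<open>x\<^sub>0, \<dots>, x\<^sub>n\<close>, including zero.\<close>

definition forms :: "nat \<Rightarrow> nat \<Rightarrow> mpoly set" where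
  "forms n d = {F. \<forall>m\<in>Poly_Mapping.keys F. Poly_Mapping.keys m \<subseteq> {..n} \<and> mdeg m = d}"

text \<open>Scalar multiplication, as multiplication by a constant polynomial.\<close>

definition smult :: "complex \<Rightarrow> mpoly \<Rightarrow> mpoly" where
  "smult c F = Poly_Mapping.single 0 c * F"

global_interpretation mpoly: vector_space smult
  by unfold_locales
    (simp_all add: smult_def single_add distrib_left distrib_right mult_single
      mult.assoc[symmetric])

text \<open>
  The subtraction of exponent vectors is truncated, but whenever truncation takes effect
  the coefficient is \<open>0\<close>.
\<close>

definition partial :: "nat \<Rightarrow> mpoly \<Rightarrow> mpoly" where
  "partial i F = (\<Sum>m\<in>Poly_Mapping.keys F.
     Poly_Mapping.single (m - Poly_Mapping.single i 1)
       (of_nat (Poly_Mapping.lookup m i) * Poly_Mapping.lookup F m))"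

definition partials :: "nat \<Rightarrow> nat \<Rightarrow> mpoly \<Rightarrow> mpoly set" where
  "partials n s F = {foldr partial js F | js. length js = s \<and> set js \<subseteq> {..n}}"

text \<open>
  Points of a projective space are one-dimensional subspaces. \<open>proj_space W\<close> is the
  projectivization of the linear subspace \<open>W\<close>; the dimension of a linear subspace of
  projective space is one less than that of its affine cone, so the empty one has dimension \<open>-1\<close>.
\<close>

definition proj_space :: "mpoly set \<Rightarrow> mpoly set set" where
  "proj_space W = {mpoly.span {G} | G. G \<in> W \<and> G \<noteq> 0}"

definition proj_dim :: "mpoly set set \<Rightarrow> int" where
  "proj_dim H = int (mpoly.dim (\<Union>H)) - 1"

definition H_partial :: "nat \<Rightarrow> nat \<Rightarrow> mpoly \<Rightarrow> mpoly set set" where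
  "H_partial n s F = proj_space (mpoly.span (partials n s F))"

definition veronese :: "nat \<Rightarrow> nat \<Rightarrow> mpoly set set" where
  "veronese n e = {mpoly.span {L ^ e} | L. L \<in> forms n 1 \<and> L \<noteq> 0}"

text \<open>
  Only the values of \<open>l\<close> and \<open>L\<close> at indices below \<open>h\<close> matter. Injectivity makes the
  independence condition one on the family, not merely on the set, of powers.
\<close>

definition rank1_decomp ::
    "nat \<Rightarrow> nat \<Rightarrow> nat \<Rightarrow> mpoly \<Rightarrow> (nat \<Rightarrow> complex) \<Rightarrow> (nat \<Rightarrow> mpoly) \<Rightarrow> bool" where
  "rank1_decomp n d h F l L \<longleftrightarrow>
     (\<forall>i<h. l i \<noteq> 0 \<and> L i \<in> forms n 1) \<and>
     F = (\<Sum>i<h. smult (l i) (L i ^ d)) \<and>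
     inj_on (\<lambda>i. L i ^ d) {..<h} \<and>
     mpoly.independent ((\<lambda>i. L i ^ d) ` {..<h})"

text \<open>
  Replacing \<open>L\<^sub>i\<close> by \<open>c L\<^sub>i\<close> is compensated by replacing the coefficient
  \<open>l\<^sub>i\<close> by \<open>l\<^sub>i / c\<^sup>d\<close>.
\<close>

definition same_decomp ::
    "nat \<Rightarrow> nat \<Rightarrow> (nat \<Rightarrow> complex) \<Rightarrow> (nat \<Rightarrow> mpoly) \<Rightarrow> (nat \<Rightarrow> complex) \<Rightarrow> (nat \<Rightarrow> mpoly) \<Rightarrow> bool" where
  "same_decomp d h l L l' L' \<longleftrightarrow>
     (\<exists>p c. p permutes {..<h} \<and>
       (\<forall>i<h. c i \<noteq> 0 \<and> L' i = smult (c i) (L (p i)) \<and> l' i * c i ^ d = l (p i)))"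

definition identifiable :: "nat \<Rightarrow> nat \<Rightarrow> nat \<Rightarrow> mpoly \<Rightarrow> bool" where
  "identifiable n d h F \<longleftrightarrow>
     (\<exists>l L. rank1_decomp n d h F l L) \<and>
     (\<forall>l L l' L'. rank1_decomp n d h F l L \<longrightarrow> rank1_decomp n d h F l' L' \<longrightarrow>
        same_decomp d h l L l' L')"

end

theory Submission
  imports "HOL-Computational_Algebra.Polynomial" Defs
begin

text \<open>
  Let \<open>z\<^sub>i\<close> and \<open>w\<^sub>j\<close> be the coefficient vectors of the linear forms in two decompositions of
  \<open>F\<close>. Taking all partial derivatives of order \<open>d\<close> gives
  \<open>\<Sum> l\<^sub>i g(z\<^sub>i) = \<Sum> l'\<^sub>j g(w\<^sub>j)\<close> for every form \<open>g\<close> of degree \<open>d\<close>. For binary forms,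
  products of \<open>2h - 1\<close> linear forms already show that the two point sets agree.

  In the other cases \<open>d = 2s + 1\<close> and \<open>h - 1\<close> is the dimension of the space of forms of degree
  \<open>s\<close>. The hypotheses on \<open>H\<^sub>\<partial>\<^sub>,\<^sub>s\<close> say that a form of degree \<open>s\<close> vanishing at all but one
  of the \<open>z\<^sub>i\<close> is zero: applied to \<open>F\<close> as a differential operator it would
  otherwise put a power of some \<open>L\<^sub>j\<close> into \<open>H\<^sub>\<partial>\<^sub>,\<^sub>s\<close> or give a linear relation between the
  partial derivatives. Consequently a form
  of degree \<open>s + 1\<close> that vanishes at all \<open>z\<^sub>i\<close> and at one \<open>w\<^sub>j\<close> vanishes at all \<open>w\<^sub>j\<close>, whereas
  the forms of degree \<open>s + 1\<close> through all \<open>z\<^sub>i\<close> have no further common zero. So the two point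
  sets are equal or disjoint, and disjointness is excluded geometrically: for cubic surfaces each
  of the six lines through two of \<open>w\<^sub>0, \<dots>, w\<^sub>3\<close> would contain one of the five \<open>z\<^sub>i\<close>, and no two
  of them the same one; for plane quintics a linear syzygy between cubics through the \<open>z\<^sub>i\<close>
  would force the \<open>w\<^sub>j\<close> to be collinear.
\<close>

section \<open>Derivatives of powers of linear forms\<close>

lemma partial_superset:
  assumes "finite A" "Poly_Mapping.keys F \<subseteq> A"
  shows "partial i F = (\<Sum>m\<in>A. Poly_Mapping.single (m - Poly_Mapping.single i 1)
       (of_nat (Poly_Mapping.lookup m i) * Poly_Mapping.lookup F m))"
  unfolding partial_def using assms
  by (intro sum.mono_neutral_left) (auto simp: in_keys_iff)

lemma partial_zero [simp]: "partial i 0 = 0"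
  by (simp add: partial_def)

lemma partial_add: "partial i (F + G) = partial i F + partial i G"
proof -
  let ?A = "Poly_Mapping.keys F \<union> Poly_Mapping.keys G"
  have *: "finite ?A" "Poly_Mapping.keys F \<subseteq> ?A" "Poly_Mapping.keys G \<subseteq> ?A"
      "Poly_Mapping.keys (F + G) \<subseteq> ?A"
    using keys_add[of F G] by auto
  show ?thesis
    by (simp add: partial_superset[OF *(1,2)] partial_superset[OF *(1,3)]
        partial_superset[OF *(1,4)] lookup_add distrib_left single_add sum.distrib)
qed

lemma partial_sum: "partial i (\<Sum>k\<in>A. f k) = (\<Sum>k\<in>A. partial i (f k))"
  by (induction A rule: infinite_finite_induct) (auto simp: partial_add)

lemma partial_single:
  "partial i (Poly_Mapping.single m a) =
    Poly_Mapping.single (m - Poly_Mapping.single i 1) (of_nat (Poly_Mapping.lookup m i) * a)"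
  by (subst partial_superset[of "{m}"]) auto

lemma mpoly_expand: "F = (\<Sum>m\<in>Poly_Mapping.keys F. Poly_Mapping.single m (Poly_Mapping.lookup F m))"
  for F :: mpoly
proof (rule poly_mapping_eqI)
  fix k
  show "Poly_Mapping.lookup F k = Poly_Mapping.lookup
      (\<Sum>m\<in>Poly_Mapping.keys F. Poly_Mapping.single m (Poly_Mapping.lookup F m)) k"
    by (auto simp: lookup_sum lookup_single when_def sum.delta in_keys_iff)
qed

lemma monom_diff_add:
  fixes m m' :: monom
  assumes "Poly_Mapping.lookup m i > 0"
  shows "m + m' - Poly_Mapping.single i 1 = m - Poly_Mapping.single i 1 + m'"
proof (rule poly_mapping_eqI)
  fix k
  show "Poly_Mapping.lookup (m + m' - Poly_Mapping.single i 1) k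
      = Poly_Mapping.lookup (m - Poly_Mapping.single i 1 + m') k"
    using assms by (cases "k = i") (auto simp: lookup_add lookup_minus lookup_single)
qed

lemma partial_mult_single:
  "partial i (Poly_Mapping.single m a * Poly_Mapping.single m' b) =
    partial i (Poly_Mapping.single m a) * Poly_Mapping.single m' b +
    Poly_Mapping.single m a * partial i (Poly_Mapping.single m' b)"
proof -
  let ?e = "Poly_Mapping.single i (1::nat)"
  let ?c = "of_nat (Poly_Mapping.lookup m i) :: complex"
  let ?c' = "of_nat (Poly_Mapping.lookup m' i) :: complex"
  \<comment> \<open>Truncated subtraction commutes with adding \<open>m'\<close> unless the variable
    \<open>i\<close> is absent from \<open>m\<close>, and then the coefficient \<open>?c\<close> is
    zero.\<close>
  have 1: "Poly_Mapping.single (m + m' - ?e) (?c * (a * b))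
      = Poly_Mapping.single (m - ?e + m') (?c * a * b)"
    by (cases "Poly_Mapping.lookup m i = 0") (auto simp: monom_diff_add mult.assoc simp del: One_nat_def)
  have 2: "Poly_Mapping.single (m + m' - ?e) (?c' * (a * b))
      = Poly_Mapping.single (m + (m' - ?e)) (a * (?c' * b))"
  proof (cases "Poly_Mapping.lookup m' i = 0")
    case False
    then show ?thesis using monom_diff_add[of m' i m] by (simp add: ac_simps del: One_nat_def)
  qed simp
  show ?thesis
    by (simp add: mult_single partial_single lookup_add distrib_right single_add 1[symmetric] 2[symmetric] del: One_nat_def)
qed

lemma partial_mult: "partial i (F * G) = partial i F * G + F * partial i G"
proof -
  let ?s = "\<lambda>F m. Poly_Mapping.single m (Poly_Mapping.lookup F m)"
  let ?A = "Poly_Mapping.keys F" and ?B = "Poly_Mapping.keys G"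
  have *: "partial i (sum (?s F) ?A * sum (?s G) ?B)
      = partial i (sum (?s F) ?A) * sum (?s G) ?B + sum (?s F) ?A * partial i (sum (?s G) ?B)"
    by (simp add: sum_product partial_sum partial_mult_single sum.distrib)
  then show ?thesis by (simp only: mpoly_expand[symmetric])
qed

lemma partial_smult: "partial i (smult c F) = smult c (partial i F)"
  by (simp add: smult_def partial_mult partial_single)

section \<open>Coordinates of linear forms and derivatives of their powers\<close>

definition coord :: "mpoly \<Rightarrow> nat \<Rightarrow> complex" where
  "coord L i = Poly_Mapping.lookup L (Poly_Mapping.single i 1)"

lemma mdeg_one_single:
  assumes "mdeg m = 1"
  shows "\<exists>j. m = Poly_Mapping.single j 1"
proof -
  have "(\<Sum>i\<in>Poly_Mapping.keys m. Poly_Mapping.lookup m i) = 1"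
    using assms by (simp add: mdeg_def)
  then obtain j where j: "j \<in> Poly_Mapping.keys m" "Poly_Mapping.lookup m j = 1"
      "\<forall>y\<in>Poly_Mapping.keys m. j \<noteq> y \<longrightarrow> Poly_Mapping.lookup m y = 0"
    using sum_eq_1_iff[of "Poly_Mapping.keys m" "Poly_Mapping.lookup m"]
    by (auto simp del: One_nat_def)
  have "m = Poly_Mapping.single j 1"
  proof (rule poly_mapping_eqI)
    fix k show "Poly_Mapping.lookup m k = Poly_Mapping.lookup (Poly_Mapping.single j 1) k"
      using j by (cases "k = j") (auto simp: lookup_single in_keys_iff when_def)
  qed
  then show ?thesis ..
qed

lemma forms_1_keys:
  assumes "L \<in> forms n 1" "m \<in> Poly_Mapping.keys L"
  shows "\<exists>j\<le>n. m = Poly_Mapping.single j 1"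
proof -
  have "mdeg m = 1" "Poly_Mapping.keys m \<subseteq> {..n}" using assms by (auto simp: forms_def)
  then obtain j where "m = Poly_Mapping.single j 1" using mdeg_one_single by blast
  with \<open>Poly_Mapping.keys m \<subseteq> {..n}\<close> show ?thesis by auto
qed

lemma forms_1_expand:
  assumes "L \<in> forms n 1"
  shows "L = (\<Sum>j\<le>n. Poly_Mapping.single (Poly_Mapping.single j 1) (coord L j))"
proof (rule poly_mapping_eqI)
  fix m
  have inj: "(Poly_Mapping.single j (1::nat) = Poly_Mapping.single k 1) = (j = k)" for j k :: nat
    by (metis keys_single one_neq_zero singleton_inject)
  show "Poly_Mapping.lookup L m = Poly_Mapping.lookup
      (\<Sum>j\<le>n. Poly_Mapping.single (Poly_Mapping.single j 1) (coord L j)) m"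
  proof (cases "\<exists>j\<le>n. m = Poly_Mapping.single j 1")
    case True
    then obtain j where "j \<le> n" "m = Poly_Mapping.single j 1" by blast
    then show ?thesis by (simp add: lookup_sum lookup_single when_def inj coord_def del: One_nat_def)
  next
    case False
    with forms_1_keys[OF assms, of m] have "Poly_Mapping.lookup L m = 0"
      by (auto simp: in_keys_iff)
    moreover have "Poly_Mapping.lookup
      (\<Sum>j\<le>n. Poly_Mapping.single (Poly_Mapping.single j 1) (coord L j)) m = 0"
      unfolding lookup_sum using False by (intro sum.neutral) (auto simp: lookup_single when_def)
    ultimately show ?thesis by simp
  qed
qed

lemma forms_1_eq_smult:
  assumes "L \<in> forms n 1" "M \<in> forms n 1" "\<And>j. j \<le> n \<Longrightarrow> coord M j = t * coord L j"
  shows "M = smult t L"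
proof -
  have "M = (\<Sum>j\<le>n. Poly_Mapping.single (Poly_Mapping.single j 1) (t * coord L j))"
    using forms_1_expand[OF assms(2)] assms(3) by simp
  also have "\<dots> = smult t (\<Sum>j\<le>n. Poly_Mapping.single (Poly_Mapping.single j 1) (coord L j))"
    by (simp add: smult_def sum_distrib_left mult_single)
  also have "\<dots> = smult t L" using forms_1_expand[OF assms(1)] by simp
  finally show ?thesis .
qed

lemma partial_linear_form:
  assumes "L \<in> forms n 1" "i \<le> n"
  shows "partial i L = smult (coord L i) 1"
proof -
  have "partial i L = (\<Sum>j\<le>n. if j = i then Poly_Mapping.single 0 (coord L i) else 0)"
    by (subst forms_1_expand[OF assms(1)])
      (unfold partial_sum partial_single lookup_single when_def, rule sum.cong, simp_all)
  also have "\<dots> = smult (coord L i) 1"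
    using assms(2) by (simp add: smult_def)
  finally show ?thesis .
qed

lemma smult_mult_left: "smult c F * G = smult c (F * G)"
  and smult_mult_right: "F * smult c G = smult c (F * G)"
  by (simp_all add: smult_def mult.assoc mult.left_commute)

lemma partial_power:
  assumes "L \<in> forms n 1" "i \<le> n"
  shows "partial i (L ^ Suc k) = smult (of_nat (Suc k) * coord L i) (L ^ k)"
proof (induction k)
  case 0
  then show ?case using partial_linear_form[OF assms] by simp
next
  case (Suc k)
  have "partial i (L ^ Suc (Suc k)) = partial i L * L ^ Suc k + L * partial i (L ^ Suc k)"
    by (subst power_Suc) (rule partial_mult)
  also have "\<dots> = smult (coord L i) (L ^ Suc k) + smult (of_nat (Suc k) * coord L i) (L ^ Suc k)"
    unfolding Suc.IH partial_linear_form[OF assms] by (simp add: smult_mult_left smult_mult_right)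
  also have "\<dots> = smult (of_nat (Suc (Suc k)) * coord L i) (L ^ Suc k)"
    by (simp only: mpoly.scale_left_distrib[symmetric]) (simp add: distrib_right)
  finally show ?case .
qed

text \<open>One list of indices serves both as a monomial function and, through
  \<open>foldr partial\<close>, as the differential operator with that symbol.\<close>

definition mon :: "nat list \<Rightarrow> (nat \<Rightarrow> complex) \<Rightarrow> complex" where
  "mon js v = prod_list (map v js)"

text \<open>Each derivative lowers the exponent by one and contributes a coordinate of
  \<open>L\<close>; the quotient of factorials is the falling factorial collected on the way. So an
  operator acts on a power of \<open>L\<close> through the value of its symbol at the coefficient
  vector.\<close>

lemma partials_power:
  assumes "L \<in> forms n 1" "set js \<subseteq> {..n}" "length js \<le> d"
  shows "foldr partial js (L ^ d) =
    smult (fact d / fact (d - length js) * mon js (coord L)) (L ^ (d - length js))"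
  using assms(2,3)
proof (induction js)
  case Nil
  then show ?case by (simp add: mon_def)
next
  case (Cons j js)
  define e where "e = d - length (j # js)"
  then have e: "d - length js = Suc e" using Cons.prems by simp
  have "foldr partial (j # js) (L ^ d) =
      smult (fact d / fact (Suc e) * mon js (coord L)) (partial j (L ^ Suc e))"
    using Cons.IH Cons.prems e by (simp add: partial_smult)
  also have "\<dots> = smult (fact d / fact (Suc e) * mon js (coord L) * (of_nat (Suc e) * coord L j)) (L ^ e)"
    using Cons.prems partial_power[OF assms(1), of j e] by simp
  also have "fact d / fact (Suc e) * mon js (coord L) * (of_nat (Suc e) * coord L j)
      = fact d / fact e * mon (j # js) (coord L)"
  proof -
    have "fact (Suc e) = (of_nat (Suc e) * fact e :: complex)" by simp
    moreover have "(of_nat (Suc e) :: complex) \<noteq> 0" by (rule of_nat_neq_0)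
    ultimately show ?thesis by (simp add: mon_def del: of_nat_Suc fact_Suc)
  qed
  finally show ?case by (simp add: e_def)
qed

lemma foldr_partial_sum_smult:
  "foldr partial js (\<Sum>i\<in>A. smult (c i) (f i)) = (\<Sum>i\<in>A. smult (c i) (foldr partial js (f i)))"
  by (induction js) (auto simp: partial_sum partial_smult)

lemma partials_power_sum:
  assumes "\<And>i. i < h \<Longrightarrow> L i \<in> forms n 1" "set js \<subseteq> {..n}" "length js \<le> d"
  shows "foldr partial js (\<Sum>i<h. smult (l i) (L i ^ d)) = smult (fact d / fact (d - length js))
    (\<Sum>i<h. smult (l i * mon js (coord (L i))) (L i ^ (d - length js)))"
  unfolding foldr_partial_sum_smult mpoly.scale_sum_right
  using partials_power[OF assms(1) assms(2,3)] by (intro sum.cong) (simp_all add: mult.left_commute)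

section \<open>Forms as functions of a point\<close>

text \<open>Sorted lists pick one representative per monomial, so \<open>card (words n d)\<close> is
  the dimension of the space of forms.\<close>

definition words :: "nat \<Rightarrow> nat \<Rightarrow> nat list set" where
  "words n d = {js. length js = d \<and> set js \<subseteq> {..n} \<and> sorted js}"

lemma words_code: "words n d = set (filter sorted (List.n_lists d [0..<Suc n]))"
  by (auto simp: words_def set_n_lists)

lemma finite_words [simp]: "finite (words n d)"
  by (simp add: words_code)

lemma card_words: "card (words n d) = length (filter sorted (List.n_lists d [0..<Suc n]))"
  by (simp only: words_code) (intro distinct_card distinct_filter distinct_n_lists distinct_upt)

text \<open>Forms are functions here: equalities are pointwise, and a nonzero coefficient family
  does not by definition give a nonzero form.\<close>

definition hform :: "nat \<Rightarrow> nat \<Rightarrow> ((nat \<Rightarrow> complex) \<Rightarrow> complex) set" where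
  "hform n d = range (\<lambda>c v. \<Sum>js\<in>words n d. c js * mon js v)"

lemma hformI: "f = (\<lambda>v. \<Sum>js\<in>words n d. c js * mon js v) \<Longrightarrow> f \<in> hform n d"
  unfolding hform_def by blast

lemma hformE:
  assumes "f \<in> hform n d"
  obtains c where "f = (\<lambda>v. \<Sum>js\<in>words n d. c js * mon js v)"
  using assms unfolding hform_def by blast

lemma hform_zero: "(\<lambda>_. 0) \<in> hform n d"
  by (rule hformI[where c = "\<lambda>_. 0"]) simp

lemma hform_add:
  assumes "f \<in> hform n d" "g \<in> hform n d"
  shows "(\<lambda>v. f v + g v) \<in> hform n d"
proof -
  obtain c where "f = (\<lambda>v. \<Sum>js\<in>words n d. c js * mon js v)" using assms(1) by (rule hformE)
  moreover obtain c' where "g = (\<lambda>v. \<Sum>js\<in>words n d. c' js * mon js v)"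
    using assms(2) by (rule hformE)
  ultimately show ?thesis
    by (intro hformI[where c = "\<lambda>js. c js + c' js"]) (simp add: sum.distrib distrib_right)
qed
lemma hform_scale:
  assumes "f \<in> hform n d"
  shows "(\<lambda>v. a * f v) \<in> hform n d"
proof -
  obtain c where "f = (\<lambda>v. \<Sum>js\<in>words n d. c js * mon js v)" using assms by (rule hformE)
  then show ?thesis
    by (intro hformI[where c = "\<lambda>js. a * c js"]) (simp add: sum_distrib_left mult.assoc)
qed

lemma hform_diff:
  assumes "f \<in> hform n d" "g \<in> hform n d"
  shows "(\<lambda>v. f v - g v) \<in> hform n d"
  using hform_add[OF assms(1) hform_scale[OF assms(2), of "-1"]] by simp

lemma hform_sum:
  assumes "\<And>i. i \<in> A \<Longrightarrow> f i \<in> hform n d"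
  shows "(\<lambda>v. \<Sum>i\<in>A. f i v) \<in> hform n d"
  using assms by (induction A rule: infinite_finite_induct) (auto simp: hform_zero hform_add)

lemma mon_sort: "mon (sort js) v = mon js v"
  unfolding mon_def by (metis mset_map mset_sort prod_mset_prod_list)

lemma mon_Cons [simp]: "mon (j # js) v = v j * mon js v"
  by (simp add: mon_def)

lemma mon_Nil [simp]: "mon [] v = 1"
  by (simp add: mon_def)

lemma mon_append: "mon (js @ ks) v = mon js v * mon ks v"
  by (simp add: mon_def)

lemma hform_mon:
  assumes "length js = d" "set js \<subseteq> {..n}"
  shows "mon js \<in> hform n d"
proof (rule hformI[where c = "\<lambda>ks. if ks = sort js then 1 else 0"], rule ext)
  fix v
  have "sort js \<in> words n d" using assms by (auto simp: words_def)
  then show "mon js v = (\<Sum>ks\<in>words n d. (if ks = sort js then 1 else 0) * mon ks v)"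
    by (simp add: if_distrib[of "\<lambda>x. x * _"] mon_sort cong: if_cong)
qed

lemma hform_induct [consumes 1, case_names zero add scale mon]:
  assumes f: "f \<in> hform n d"
    and zero: "P (\<lambda>_. 0)"
    and add: "\<And>f g. P f \<Longrightarrow> P g \<Longrightarrow> P (\<lambda>v. f v + g v)"
    and scale: "\<And>c f. P f \<Longrightarrow> P (\<lambda>v. c * f v)"
    and mon: "\<And>js. length js = d \<Longrightarrow> set js \<subseteq> {..n} \<Longrightarrow> P (mon js)"
  shows "P f"
proof -
  obtain c where c: "f = (\<lambda>v. \<Sum>js\<in>words n d. c js * mon js v)" using f by (rule hformE)
  have "P (\<lambda>v. \<Sum>js\<in>A. c js * mon js v)" if "finite A" "A \<subseteq> words n d" for A
    using that
  proof (induction A)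
    case (insert js A)
    then have "P (\<lambda>v. c js * mon js v)" by (intro scale mon) (auto simp: words_def)
    from add[OF this] insert show ?case by simp
  qed (simp add: zero)
  from this[of "words n d"] show ?thesis by (simp add: c)
qed

lemma hform_mult:
  assumes "f \<in> hform n d" "g \<in> hform n e"
  shows "(\<lambda>v. f v * g v) \<in> hform n (d + e)"
  using assms(1)
proof (induction rule: hform_induct)
  case (mon js)
  from assms(2) show ?case
  proof (induction rule: hform_induct)
    case (mon ks)
    then show ?case using hform_mon[of "js @ ks" "d + e" n] \<open>length js = d\<close> \<open>set js \<subseteq> {..n}\<close>
      by (simp add: mon_append[abs_def])
  next
    case (add f g)
    then show ?case using hform_add by (simp add: distrib_left)
  next
    case (scale c f)
    from hform_scale[OF this, of c] show ?case by (simp add: mult.left_commute)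
  qed (simp add: hform_zero)
next
  case (add f g)
  then show ?case using hform_add by (simp add: distrib_right)
next
  case (scale c f)
  from hform_scale[OF this, of c] show ?case by (simp add: mult.assoc)
qed (simp add: hform_zero)

lemma hform_const: "(\<lambda>_. c) \<in> hform n 0"
  using hform_scale[OF hform_mon[of "[]" 0 n], of c] by simp

lemma hform_var: "i \<le> n \<Longrightarrow> (\<lambda>v. v i) \<in> hform n 1"
  using hform_mon[of "[i]" 1 n] by (simp add: mon_def[abs_def])

lemma hform_prod:
  assumes "finite A" "\<And>i. i \<in> A \<Longrightarrow> f i \<in> hform n 1"
  shows "(\<lambda>v. \<Prod>i\<in>A. f i v) \<in> hform n (card A)"
  using assms by (induction A) (use hform_mult[of _ n 1] in \<open>auto simp: hform_const\<close>)

lemma mon_scale: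
  assumes "set js \<subseteq> {..n}" "\<And>i. i \<le> n \<Longrightarrow> w i = t * v i"
  shows "mon js w = t ^ length js * mon js v"
  using assms(1) by (induction js) (auto simp: assms(2))

lemma hform_homogeneous:
  assumes "f \<in> hform n d" "\<And>i. i \<le> n \<Longrightarrow> w i = t * v i"
  shows "f w = t ^ d * f v"
  using assms(1) by (induction rule: hform_induct) (use mon_scale[OF _ assms(2)] in \<open>auto simp: algebra_simps\<close>)

lemma hform_1_linear:
  assumes "f \<in> hform n 1"
  shows "f (\<lambda>i. a * v i + b * w i) = a * f v + b * f w"
  using assms by (induction rule: hform_induct) (auto simp: length_Suc_conv algebra_simps)

lemma hform_line_poly:
  assumes "f \<in> hform n d"
  shows "\<exists>p. \<forall>t. f (\<lambda>i. v i + t * u i) = poly p t"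
  using assms
proof (induction rule: hform_induct)
  case zero
  show ?case by (rule exI[of _ 0]) simp
next
  case (add f g)
  then obtain p q where "\<forall>t. f (\<lambda>i. v i + t * u i) = poly p t" "\<forall>t. g (\<lambda>i. v i + t * u i) = poly q t"
    by blast
  then show ?case by (intro exI[of _ "p + q"]) simp
next
  case (scale c f)
  then obtain p where "\<forall>t. f (\<lambda>i. v i + t * u i) = poly p t" by blast
  then show ?case by (intro exI[of _ "[:c:] * p"]) simp
next
  case (mon js)
  show ?case
  proof (rule exI[of _ "prod_list (map (\<lambda>j. [:v j, u j:]) js)"], rule allI)
    fix t show "mon js (\<lambda>i. v i + t * u i) = poly (prod_list (map (\<lambda>j. [:v j, u j:]) js)) t"
      by (induction js) (auto simp: algebra_simps)
  qed
qed

text \<open>On the line from \<open>u\<close> to \<open>v\<close> both forms become polynomials in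
  one variable with product zero. The first is nonzero at parameter 0, so the second is the zero
  polynomial.\<close>

lemma hform_zero_divisor:
  assumes "f \<in> hform n d" "g \<in> hform n e" "\<And>v. f v * g v = 0" "f u \<noteq> 0"
  shows "g v = 0"
proof -
  let ?l = "\<lambda>t i. u i + t * (v i - u i)"
  obtain p where p: "\<And>t. f (?l t) = poly p t" using hform_line_poly[OF assms(1)] by metis
  obtain q where q: "\<And>t. g (?l t) = poly q t" using hform_line_poly[OF assms(2)] by metis
  have "poly (p * q) t = 0" for t using assms(3)[of "?l t"] p q by simp
  then have "p * q = 0" using poly_all_0_iff_0[of "p * q"] by blast
  moreover have "poly p 0 \<noteq> 0" using p[of 0] assms(4) by simp
  ultimately have "q = 0" by auto
  then show ?thesis using q[of 1] by simp
qed

lemma hform_subst: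
  assumes "f \<in> hform n d" "\<And>i. i \<le> n \<Longrightarrow> (\<lambda>v. \<phi> v i) \<in> hform n 1"
  shows "(\<lambda>v. f (\<phi> v)) \<in> hform n d"
  using assms(1)
proof (induction rule: hform_induct)
  case (mon js)
  then show ?case
  proof (induction js arbitrary: d)
    case (Cons j js)
    then have "(\<lambda>v. mon js (\<phi> v)) \<in> hform n (length js)" by simp
    from hform_mult[OF assms(2) this, of j] Cons show ?case by auto
  qed (auto simp: hform_const)
qed (auto simp: hform_zero hform_add hform_scale)

text \<open>Division with remainder by the linear form \<open>a\<close>; when \<open>a u = 1\<close>, the remainder is the
  restriction of \<open>f\<close> to the hyperplane \<open>a = 0\<close>, pulled back by the projection along \<open>u\<close>.\<close>

lemma hform_division:
  assumes "f \<in> hform n (Suc d)" "a \<in> hform n 1"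
  shows "\<exists>g\<in>hform n d. \<forall>v. f v = f (\<lambda>i. v i - a v * u i) + a v * g v"
  using assms(1)
proof (induction rule: hform_induct)
  case zero
  show ?case by (rule bexI[OF _ hform_zero]) simp
next
  case (add f f')
  then obtain g g' where g: "g \<in> hform n d" "\<And>v. f v = f (\<lambda>i. v i - a v * u i) + a v * g v"
    and g': "g' \<in> hform n d" "\<And>v. f' v = f' (\<lambda>i. v i - a v * u i) + a v * g' v"
    by blast
  have *: "f v + f' v = f (\<lambda>i. v i - a v * u i) + f' (\<lambda>i. v i - a v * u i) + a v * (g v + g' v)" for v
    using g(2)[of v] g'(2)[of v] by (simp add: distrib_left)
  show ?case by (rule bexI[OF _ hform_add[OF g(1) g'(1)]], rule allI, rule *)
next
  case (scale c f)
  then obtain g where g: "g \<in> hform n d" "\<And>v. f v = f (\<lambda>i. v i - a v * u i) + a v * g v"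
    by blast
  show ?case
    using g(2) by (intro bexI[where x = "\<lambda>v. c * g v"] hform_scale g(1) allI) (metis distrib_left mult.left_commute)
next
  case (mon js)
  then show ?case
  proof (induction js arbitrary: d)
    case (Cons j js)
    let ?y = "\<lambda>v i. v i - a v * u i"
    have j: "(\<lambda>v. ?y v j) \<in> hform n 1"
      using hform_diff[OF hform_var hform_scale[OF assms(2), of "u j"]] Cons.prems
      by (simp add: mult.commute)
    have js: "mon js \<in> hform n d" using Cons.prems by (intro hform_mon) auto
    show ?case
    proof (cases js)
      case Nil
      then show ?thesis using Cons.prems
        by (intro bexI[where x = "\<lambda>_. u j"]) (auto simp: hform_const)
    next
      case (Cons k ks)
      then obtain e where e: "d = Suc e" "length js = Suc e" using Cons.prems by auto
      then obtain g where g: "g \<in> hform n e" "\<And>v. mon js v = mon js (?y v) + a v * g v"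
        using Cons.IH[of e] Cons.prems by auto
      \<comment> \<open>Writing \<open>v j\<close> as \<open>?y v j + a v * u j\<close> and
        substituting the division of \<open>mon js\<close> yields this quotient.\<close>
      have "(\<lambda>v. u j * mon js v + ?y v j * g v) \<in> hform n d"
        using hform_add[OF hform_scale[OF js, of "u j"]] hform_mult[OF j g(1)] e by simp
      then show ?thesis
      proof (rule bexI[rotated], intro allI)
        fix v
        show "mon (j # js) v = mon (j # js) (?y v) + a v * (u j * mon js v + ?y v j * g v)"
          using g(2)[of v] by (simp add: algebra_simps)
      qed
    qed
  qed simp
qed

section \<open>Homogeneous linear systems and dimension counts for forms\<close>

text \<open>Gaussian elimination, with unknowns indexed by \<open>I\<close> and equations by
  \<open>S\<close>: each induction step removes one equation and at most one unknown.\<close>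

lemma homogeneous_system_solution:
  fixes e :: "'i \<Rightarrow> 'p \<Rightarrow> complex"
  assumes "finite S" "finite I" "card S < card I"
  shows "\<exists>c. (\<exists>i\<in>I. c i \<noteq> 0) \<and> (\<forall>p\<in>S. (\<Sum>i\<in>I. c i * e i p) = 0)"
  using assms
proof (induction S arbitrary: I e rule: finite_induct)
  case empty
  then have "I \<noteq> {}" by auto
  then show ?case by (intro exI[of _ "\<lambda>_. 1"]) auto
next
  case (insert p S)
  show ?case
  proof (cases "\<forall>i\<in>I. e i p = 0")
    case True
    then show ?thesis using insert.IH[of I e] insert.prems insert.hyps by auto
  next
    case False
    then obtain k where k: "k \<in> I" "e k p \<noteq> 0" by auto
    define e' where "e' i q = e i q - e i p / e k p * e k q" for i q
    have "card S < card (I - {k})" using insert k by simp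
    from insert.IH[OF _ this, of e'] obtain c where
      c: "\<exists>i\<in>I - {k}. c i \<noteq> 0" "\<forall>q\<in>S. (\<Sum>i\<in>I - {k}. c i * e' i q) = 0" using insert.prems by auto
    \<comment> \<open>Back substitution: the value at \<open>k\<close> is the one forced by equation
      \<open>p\<close>.\<close>
    define c' where "c' i = (if i = k then - (\<Sum>i\<in>I - {k}. c i * e i p) / e k p else c i)" for i
    have split: "(\<Sum>i\<in>I. c' i * e i q) = (\<Sum>i\<in>I - {k}. c i * e' i q)" for q
    proof -
      have "(\<Sum>i\<in>I. c' i * e i q) = c' k * e k q + (\<Sum>i\<in>I - {k}. c i * e i q)"
        using k insert.prems by (simp add: sum.remove c'_def)
      also have "c' k * e k q = - (\<Sum>i\<in>I - {k}. c i * (e i p / e k p * e k q))"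
        by (simp add: c'_def sum_distrib_right sum_divide_distrib mult.assoc)
      finally show ?thesis by (simp add: e'_def right_diff_distrib sum_subtractf)
    qed
    have "e' i p = 0" for i using k by (simp add: e'_def)
    then have "\<forall>q\<in>insert p S. (\<Sum>i\<in>I. c' i * e i q) = 0" using c(2) split by simp
    moreover have "\<exists>i\<in>I. c' i \<noteq> 0" using c(1) by (auto simp: c'_def)
    ultimately show ?thesis by blast
  qed
qed

text \<open>Each monomial gives one linear equation for the coefficients of a relation between the
  \<open>F i\<close>.\<close>

lemma hform_dependent:
  assumes "finite I" "card (words n d) < card I" "\<And>i. i \<in> I \<Longrightarrow> F i \<in> hform n d"
  shows "\<exists>c. (\<exists>i\<in>I. c i \<noteq> 0) \<and> (\<forall>v. (\<Sum>i\<in>I. c i * F i v) = 0)"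
proof -
  have "\<forall>i\<in>I. \<exists>c. F i = (\<lambda>v. \<Sum>js\<in>words n d. c js * mon js v)"
    using assms(3) hformE by blast
  from bchoice[OF this] obtain e
    where e: "\<And>i. i \<in> I \<Longrightarrow> F i = (\<lambda>v. \<Sum>js\<in>words n d. e i js * mon js v)" by blast
  obtain c where c: "\<exists>i\<in>I. c i \<noteq> 0" "\<forall>js\<in>words n d. (\<Sum>i\<in>I. c i * e i js) = 0"
    using homogeneous_system_solution[OF finite_words assms(1,2), of e] by blast
  have "(\<Sum>i\<in>I. c i * F i v) = 0" for v
  proof -
    have "(\<Sum>i\<in>I. c i * F i v) = (\<Sum>i\<in>I. \<Sum>js\<in>words n d. c i * e i js * mon js v)"
      by (intro sum.cong) (simp_all add: e sum_distrib_left mult.assoc)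
    also have "\<dots> = (\<Sum>js\<in>words n d. (\<Sum>i\<in>I. c i * e i js) * mon js v)"
      by (subst sum.swap) (simp add: sum_distrib_right)
    finally show ?thesis using c(2) by simp
  qed
  with c(1) show ?thesis by blast
qed

lemma hform_vanishing_coeffs:
  assumes "finite S" "card S < card (words n d)"
  shows "\<exists>c. (\<exists>js\<in>words n d. c js \<noteq> 0) \<and> (\<forall>p\<in>S. (\<Sum>js\<in>words n d. c js * mon js p) = 0)"
  using homogeneous_system_solution[OF assms(1) finite_words assms(2), of mon] .

lemma linear_form_vanishing:
  assumes "finite S" "card S \<le> n"
  shows "\<exists>a\<in>hform n 1. (\<exists>v. a v \<noteq> 0) \<and> (\<forall>p\<in>S. a p = 0)"
proof -
  obtain c where c: "\<exists>i\<in>{..n}. c i \<noteq> 0" "\<forall>p\<in>S. (\<Sum>i\<le>n. c i * p i) = 0"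
    using homogeneous_system_solution[OF assms(1), of "{..n}" "\<lambda>i p. p i"] assms(2) by force
  let ?a = "\<lambda>v. \<Sum>i\<le>n. c i * v i"
  have "?a \<in> hform n 1" by (intro hform_sum hform_scale hform_var) auto
  moreover obtain k where k: "k \<le> n" "c k \<noteq> 0" using c(1) by blast
  have "?a (\<lambda>i. if i = k then 1 else 0) = c k" using k by (simp add: if_distrib cong: if_cong)
  then have "?a (\<lambda>i. if i = k then 1 else 0) \<noteq> 0" using k by simp
  then have "\<exists>v. ?a v \<noteq> 0" by (rule exI[where P = "\<lambda>v. ?a v \<noteq> 0"])
  ultimately show ?thesis using c(2) by (intro bexI[of _ ?a] conjI)
qed

lemma poly_eq_0I: "(\<And>t. poly p t = 0) \<Longrightarrow> p = 0" for p :: "complex poly"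
  using poly_all_0_iff_0[of p] by blast

text \<open>Nine conditions are fewer than the ten cubic monomials; what remains is that a nonzero
  coefficient family gives a nonzero function.\<close>

lemma ternary_cubic_vanishing:
  assumes "finite S" "card S \<le> 9"
  shows "\<exists>f\<in>hform 2 3. (\<exists>v. f v \<noteq> 0) \<and> (\<forall>p\<in>S. f p = 0)"
proof -
  have W: "words 2 3 = {[0,0,0],[0,0,1],[0,1,1],[1,1,1],[0,0,2],[0,1,2],[1,1,2],[0,2,2],[1,2,2],[2,2,2]}"
  proof -
    have "filter sorted (List.n_lists 3 [0..<Suc 2]) = [[0,0,0],[0,0,1],[0,1,1],[1,1,1],[0,0,2],[0,1,2],[1,1,2],[0,2,2],[1,2,2],[2,2,2]]" by code_simp
    then show ?thesis by (simp only: words_code list.set)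
  qed
  then have "card S < card (words 2 3)" using assms(2) by simp
  from hform_vanishing_coeffs[OF assms(1) this] obtain c where c: "\<exists>js\<in>words 2 3. c js \<noteq> 0" "\<forall>p\<in>S. (\<Sum>js\<in>words 2 3. c js * mon js p) = 0"
    by blast
  let ?f = "\<lambda>v. \<Sum>js\<in>words 2 3. c js * mon js v"
  have "\<exists>v. ?f v \<noteq> 0"
  proof (rule ccontr)
    assume "\<not> ?thesis"
    \<comment> \<open>At the points \<open>(1, t, u)\<close> the cubic is a polynomial in
      \<open>t\<close> whose coefficients are polynomials in \<open>u\<close>, and distinct
      monomials stay distinct.\<close>
    then have *: "?f (\<lambda>i. if i = 0 then 1 else if i = 1 then t else u) = 0" for t u by simp
    let ?p0 = "[:c [0,0,0], c [0,0,2], c [0,2,2], c [2,2,2]:]"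
    let ?p1 = "[:c [0,0,1], c [0,1,2], c [1,2,2]:]"
    let ?p2 = "[:c [0,1,1], c [1,1,2]:]"
    have "[:poly ?p0 u, poly ?p1 u, poly ?p2 u, c [1,1,1]:] = 0" for u
    proof -
      have "poly [:poly ?p0 u, poly ?p1 u, poly ?p2 u, c [1,1,1]:] t = 0" for t
        using *[of t u] by (simp add: W algebra_simps)
      then show ?thesis by (rule poly_eq_0I)
    qed
    then have P: "poly ?p0 u = 0" "poly ?p1 u = 0" "poly ?p2 u = 0" "c [1,1,1] = 0" for u
      by (simp_all only: pCons_eq_0_iff simp_thms)
    have "?p0 = 0" "?p1 = 0" "?p2 = 0"
      by (rule poly_eq_0I, rule P)+
    then show False using c(1) P(4) by (simp add: W)
  qed
  moreover have "?f \<in> hform 2 3" by (rule hformI) simp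
  ultimately show ?thesis using c(2) by (intro bexI[of _ ?f] conjI)
qed

lemma linear_form_separation:
  assumes "i \<le> n" "p i \<noteq> 0" "\<nexists>t. \<forall>k\<le>n. r k = t * p k"
  shows "\<exists>a\<in>hform n 1. a p = 0 \<and> a r \<noteq> 0"
proof -
  obtain k where k: "k \<le> n" "r k \<noteq> r i / p i * p k"
    using assms(3)[unfolded not_ex, rule_format, of "r i / p i"] by blast
  \<comment> \<open>The minor in columns \<open>i\<close> and \<open>k\<close> of the matrix with
    rows \<open>p\<close> and \<open>v\<close>.\<close>
  let ?a = "\<lambda>v. p i * v k - p k * v i"
  have "?a \<in> hform n 1" using k assms by (intro hform_diff hform_scale hform_var)
  moreover have "?a r \<noteq> 0" using k assms(2) by (simp add: field_simps)
  ultimately show ?thesis by (intro bexI[of _ ?a]) auto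
qed

section \<open>Point configurations on which forms of degree \<open>s\<close> are determined by all but one point\<close>

lemma hform_power:
  assumes "f \<in> hform n 1"
  shows "(\<lambda>v. f v ^ k) \<in> hform n k"
  using hform_prod[of "{..<k}" "\<lambda>_. f" n] assms by simp

text \<open>Any \<open>h - 1\<close> of the points impose independent conditions on forms of degree
  \<open>s\<close>, as many as the dimension of that space. The wording with coefficients does not
  presuppose that a form determines them.\<close>

locale point_config =
  fixes n s h :: nat and Z :: "nat \<Rightarrow> nat \<Rightarrow> complex"
  assumes n_ge: "n \<ge> 2" and s_ge: "s \<ge> 1" and h_ge: "h \<ge> 3"
    and card_words_eq: "Suc (card (words n s)) = h"
    and coeffs_zero: "\<And>c j js. j < h \<Longrightarrow>
      (\<And>i. i < h \<Longrightarrow> i \<noteq> j \<Longrightarrow> (\<Sum>js\<in>words n s. c js * mon js (Z i)) = 0) \<Longrightarrow>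
      js \<in> words n s \<Longrightarrow> c js = 0"
begin

lemma vanishes_if_all_but_one:
  assumes "q \<in> hform n s" "j < h" "\<And>i. i < h \<Longrightarrow> i \<noteq> j \<Longrightarrow> q (Z i) = 0"
  shows "q v = 0"
proof -
  obtain c where c: "q = (\<lambda>v. \<Sum>js\<in>words n s. c js * mon js v)" using assms(1) by (rule hformE)
  then have "c js = 0" if "js \<in> words n s" for js
    using coeffs_zero[OF assms(2) _ that, of c] assms(3) by simp
  then show ?thesis by (simp add: c)
qed

text \<open>\<open>h - 2\<close> conditions leave a nonzero coefficient family; vanishing at
  \<open>Z i\<close> too would contradict \<open>coeffs_zero\<close> for the ignored index
  \<open>j\<close>.\<close>

lemma separator:
  assumes "i < h" "j < h" "i \<noteq> j"
  obtains q where "q \<in> hform n s" "\<And>k. k < h \<Longrightarrow> k \<noteq> i \<Longrightarrow> k \<noteq> j \<Longrightarrow> q (Z k) = 0" "q (Z i) \<noteq> 0"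
proof -
  let ?S = "Z ` ({..<h} - {i, j})"
  have "card ?S \<le> card ({..<h} - {i, j})" by (rule card_image_le) simp
  also have "\<dots> = h - 2" using assms by (subst card_Diff_subset) auto
  also have "\<dots> < card (words n s)" using card_words_eq h_ge by simp
  finally obtain c where c: "\<exists>js\<in>words n s. c js \<noteq> 0"
      "\<forall>p\<in>?S. (\<Sum>js\<in>words n s. c js * mon js p) = 0"
    using hform_vanishing_coeffs[of ?S n s] by blast
  let ?q = "\<lambda>v. \<Sum>js\<in>words n s. c js * mon js v"
  have "?q (Z i) \<noteq> 0"
  proof
    assume 0: "?q (Z i) = 0"
    have "?q (Z k) = 0" if "k < h" "k \<noteq> j" for k
      using that 0 c(2) by (cases "k = i") auto
    then have "c js = 0" if "js \<in> words n s" for js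
      using coeffs_zero[OF assms(2) _ that, of c] by simp
    with c(1) show False by blast
  qed
  moreover have "?q \<in> hform n s" by (rule hformI) simp
  moreover have "?q (Z k) = 0" if "k < h" "k \<noteq> i" "k \<noteq> j" for k using c(2) that by simp
  ultimately show thesis by (intro that[of ?q])
qed

lemma third_index: "\<exists>k<h. k \<noteq> i \<and> k \<noteq> j"
proof -
  have "{0, 1, 2} - {i, j} \<noteq> {}"
  proof
    assume "{0, 1, 2} - {i, j} = {}"
    then have "{0::nat, 1, 2} \<subseteq> {i, j}" by blast
    then have "card {0::nat, 1, 2} \<le> card {i, j}" by (rule card_mono[rotated]) simp
    also have "\<dots> \<le> 2" by (simp add: card_insert_if)
    finally show False by simp
  qed
  then obtain k where "k \<in> {0, 1, 2}" "k \<noteq> i" "k \<noteq> j" by blast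
  with h_ge show ?thesis by (intro exI[of _ k]) auto
qed

lemma point_nonzero:
  assumes "i < h"
  shows "\<exists>k\<le>n. Z i k \<noteq> 0"
proof (rule ccontr)
  assume *: "\<not> ?thesis"
  obtain j where "j < h" "j \<noteq> i" using third_index by blast
  then obtain q where q: "q \<in> hform n s" "q (Z i) \<noteq> 0" using separator[of i j] assms by metis
  have "q (Z i) = 0 ^ s * q (Z i)" using * by (intro hform_homogeneous[OF q(1)]) auto
  with q(2) s_ge show False by (simp add: power_0_left)
qed

lemma not_proportional:
  assumes "i < h" "j < h" "i \<noteq> j"
  shows "\<nexists>t. \<forall>k\<le>n. Z i k = t * Z j k"
proof
  assume "\<exists>t. \<forall>k\<le>n. Z i k = t * Z j k"
  then obtain t where t: "\<And>k. k \<le> n \<Longrightarrow> Z i k = t * Z j k" by blast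
  obtain k where "k < h" "k \<noteq> i" "k \<noteq> j" using third_index by blast
  then obtain q where "q \<in> hform n s" "q (Z i) \<noteq> 0" "q (Z j) = 0"
    using separator[of i k] assms by metis
  with hform_homogeneous[of q n s "Z i" t "Z j"] t show False by simp
qed

lemma linear_separator:
  assumes "i < h" "j < h" "i \<noteq> j"
  obtains a where "a \<in> hform n 1" "a (Z j) = 0" "a (Z i) \<noteq> 0"
proof -
  obtain k where "k \<le> n" "Z j k \<noteq> 0" using point_nonzero assms(2) by blast
  from linear_form_separation[of k n "Z j" "Z i", OF this not_proportional[OF assms]] that
  show thesis by blast
qed

text \<open>The \<open>s\<close>-th power of such a linear form has degree \<open>s\<close> and
  vanishes at every point.\<close>

lemma no_hyperplane:
  assumes "a \<in> hform n 1" "\<And>i. i < h \<Longrightarrow> a (Z i) = 0"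
  shows "a v = 0"
proof -
  have "a v ^ s = 0"
  proof (rule vanishes_if_all_but_one[of "\<lambda>v. a v ^ s" 0])
    show "(\<lambda>v. a v ^ s) \<in> hform n s" using assms(1) by (rule hform_power)
  qed (use h_ge s_ge assms(2) in auto)
  then show ?thesis by simp
qed

text \<open>A separator for \<open>Z i\<close> that ignores \<open>Z j\<close>, times a linear form
  killing \<open>Z j\<close>, isolates \<open>Z i\<close> in degree \<open>s + 1\<close>.\<close>

lemma lagrange_basis:
  obtains F where "\<And>i. i < h \<Longrightarrow> F i \<in> hform n (Suc s)"
    "\<And>i k. i < h \<Longrightarrow> k < h \<Longrightarrow> F i (Z k) = (if k = i then 1 else 0)"
proof -
  have "\<exists>f\<in>hform n (Suc s). \<forall>k<h. f (Z k) = (if k = i then 1 else 0)" if i: "i < h" for i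
  proof -
    obtain j where j: "j < h" "j \<noteq> i" using third_index by blast
    obtain q where q: "q \<in> hform n s" "\<And>k. k < h \<Longrightarrow> k \<noteq> i \<Longrightarrow> k \<noteq> j \<Longrightarrow> q (Z k) = 0" "q (Z i) \<noteq> 0"
      using separator[of i j] i j by metis
    obtain a where a: "a \<in> hform n 1" "a (Z j) = 0" "a (Z i) \<noteq> 0"
      using linear_separator[of i j] i j by metis
    let ?f = "\<lambda>v. 1 / (q (Z i) * a (Z i)) * (q v * a v)"
    have "?f \<in> hform n (s + 1)"
      by (intro hform_scale hform_mult q a)
    then have "?f \<in> hform n (Suc s)" by simp
    moreover have "1 / (q (Z i) * a (Z i)) * (q (Z k) * a (Z k)) = (if k = i then 1 else 0)"
      if "k < h" for k 
    proof -
      consider "k = i" | "k = j" | "k \<noteq> i" "k \<noteq> j" by blast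
      then show ?thesis using that q(2)[of k] q(3) a j(2) by cases simp_all
    qed
    ultimately show ?thesis by (intro bexI[of _ ?f] allI impI)
  qed
  then have "\<forall>i\<in>{..<h}. \<exists>f. f \<in> hform n (Suc s) \<and> (\<forall>k<h. f (Z k) = (if k = i then 1 else 0))"
    by (simp add: Bex_def)
  from bchoice[OF this] obtain F where
    "\<forall>i\<in>{..<h}. F i \<in> hform n (Suc s) \<and> (\<forall>k<h. F i (Z k) = (if k = i then 1 else 0))" ..
  then show thesis by (intro that[of F]) simp_all
qed

text \<open>The hypothesis says that \<open>Z j\<close> occurs with a nonzero coefficient in a linear relation,
  on forms of degree \<open>s + 1\<close>, between evaluations at the \<open>Z i\<close> and at the points of \<open>E\<close>.\<close>

lemma in_span_of_residual:
  assumes "finite E" "card E < n" "j < h"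
    and residual: "\<And>f. f \<in> hform n (Suc s) \<Longrightarrow> (\<And>p. p \<in> E \<Longrightarrow> f p = 0) \<Longrightarrow>
      (\<And>i. i < h \<Longrightarrow> i \<noteq> j \<Longrightarrow> f (Z i) = 0) \<Longrightarrow> f (Z j) = 0"
    and a0: "a0 \<in> hform n 1" "\<And>p. p \<in> E \<Longrightarrow> a0 p = 0"
  shows "a0 (Z j) = 0"
proof (rule ccontr)
  assume nz: "a0 (Z j) \<noteq> 0"
  have "card (insert (Z j) E) \<le> n" using assms(1,2) by (simp add: card_insert_if)
  \<comment> \<open>This linear form will turn out to vanish at every \<open>Z i\<close>, against
    \<open>no_hyperplane\<close>.\<close>
  then obtain a where a: "a \<in> hform n 1" "\<exists>v. a v \<noteq> 0" "\<forall>p\<in>insert (Z j) E. a p = 0"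
    using linear_form_vanishing[of "insert (Z j) E" n] assms(1) by auto
  have "a (Z i) = 0" if i: "i < h" for i
  proof (cases "i = j")
    case False
    \<comment> \<open>\<open>?b\<close> vanishes at \<open>Z i\<close> and on \<open>E\<close>, and
      its value at \<open>Z j\<close> is \<open>a (Z i) * a0 (Z j)\<close>; so
      \<open>residual\<close>, applied to \<open>q\<close> times \<open>?b\<close>, forces
      \<open>a (Z i) = 0\<close>.\<close>
    let ?b = "\<lambda>v. a (Z i) * a0 v - a0 (Z i) * a v"
    obtain q where q: "q \<in> hform n s" "\<And>k. k < h \<Longrightarrow> k \<noteq> j \<Longrightarrow> k \<noteq> i \<Longrightarrow> q (Z k) = 0" "q (Z j) \<noteq> 0"
      using separator[of j i] i assms(3) False by metis
    let ?f = "\<lambda>v. q v * ?b v"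
    have "?f \<in> hform n (s + 1)"
      by (intro hform_mult hform_diff hform_scale q a a0)
    then have "?f \<in> hform n (Suc s)" by simp
    moreover have "?f p = 0" if "p \<in> E" for p using that a(3) a0(2) by simp
    moreover have "?f (Z k) = 0" if "k < h" "k \<noteq> j" for k
      using q(2)[OF that] by (cases "k = i") simp_all
    ultimately have "?f (Z j) = 0" by (rule residual)
    then show ?thesis using q(3) a(3) nz by simp
  qed (use a in auto)
  with no_hyperplane[OF a(1)] a(2) show False by blast
qed

text \<open>Otherwise evaluation at \<open>w\<close> in degree \<open>s + 1\<close> would be a
  combination of the evaluations at the \<open>Z i\<close>. A \<open>Z j\<close> with nonzero
  coefficient would lie in the span of \<open>w\<close> by \<open>in_span_of_residual\<close>,
  making \<open>w\<close> proportional to it.\<close>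

lemma separating_form:
  assumes "k \<le> n" "w k \<noteq> 0" "\<And>i. i < h \<Longrightarrow> \<nexists>t. \<forall>k\<le>n. w k = t * Z i k"
  shows "\<exists>f\<in>hform n (Suc s). (\<forall>i<h. f (Z i) = 0) \<and> f w \<noteq> 0"
proof (rule ccontr)
  assume "\<not> ?thesis"
  then have 0: "f w = 0" if "f \<in> hform n (Suc s)" "\<And>i. i < h \<Longrightarrow> f (Z i) = 0" for f
    using that by blast
  obtain F where F: "\<And>i. i < h \<Longrightarrow> F i \<in> hform n (Suc s)"
    "\<And>i k. i < h \<Longrightarrow> k < h \<Longrightarrow> F i (Z k) = (if k = i then 1 else 0)"
    using lagrange_basis by blast
  have expand: "f w = (\<Sum>i<h. f (Z i) * F i w)" if f: "f \<in> hform n (Suc s)" for f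
  proof -
    have "(\<lambda>v. f v - (\<Sum>i<h. f (Z i) * F i v)) \<in> hform n (Suc s)"
      using F(1) f by (intro hform_diff hform_sum hform_scale) auto
    moreover have "f (Z k) - (\<Sum>i<h. f (Z i) * F i (Z k)) = 0" if "k < h" for k
      using that F(2) by (simp add: if_distrib[of "\<lambda>x. _ * x"] cong: if_cong)
    ultimately have "f w - (\<Sum>i<h. f (Z i) * F i w) = 0" by (rule 0)
    then show ?thesis by simp
  qed
  \<comment> \<open>A form that is nonzero at \<open>w\<close> shows that some coefficient
    \<open>F j w\<close> is nonzero.\<close>
  have "(\<lambda>v. v k ^ Suc s) \<in> hform n (Suc s)"
    by (intro hform_power hform_var assms)
  from expand[OF this] have "(\<Sum>i<h. Z i k ^ Suc s * F i w) \<noteq> 0" using assms(2) by (metis power_not_zero)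
  then obtain j where "j \<in> {..<h}" "Z j k ^ Suc s * F j w \<noteq> 0" by (rule sum.not_neutral_contains_not_neutral)
  then have j: "j < h" "F j w \<noteq> 0" by simp_all
  have "a (Z j) = 0" if "a \<in> hform n 1" "a w = 0" for a
  proof (rule in_span_of_residual[of "{w}"])
    fix f assume f: "f \<in> hform n (Suc s)" "\<And>p. p \<in> {w} \<Longrightarrow> f p = 0"
      "\<And>i. i < h \<Longrightarrow> i \<noteq> j \<Longrightarrow> f (Z i) = 0"
    have "(\<Sum>i<h. f (Z i) * F i w) = f (Z j) * F j w"
      using f(3) j by (subst sum.remove[of _ j]) (auto intro!: sum.neutral)
    with expand[OF f(1)] f(2) j show "f (Z j) = 0" by simp
  qed (use that n_ge j in auto)
  then obtain t where t: "\<And>k. k \<le> n \<Longrightarrow> Z j k = t * w k"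
    using linear_form_separation[of k n w "Z j", OF assms(1,2)] by blast
  have "t \<noteq> 0" using point_nonzero[OF j(1)] t by auto
  then have "\<forall>k\<le>n. w k = inverse t * Z j k" using t by simp
  with assms(3)[OF j(1)] show False by blast
qed

end

section \<open>Two configurations whose weighted evaluations agree\<close>

locale two_configs = Z: point_config n s h Z + W: point_config n s h W
  for n s h :: nat and Z W :: "nat \<Rightarrow> nat \<Rightarrow> complex" +
  fixes l l' :: "nat \<Rightarrow> complex"
  assumes l'_nonzero: "i < h \<Longrightarrow> l' i \<noteq> 0"
    and sum_eq: "g \<in> hform n (2 * s + 1) \<Longrightarrow> (\<Sum>i<h. l i * g (Z i)) = (\<Sum>i<h. l' i * g (W i))"
begin

text \<open>Multiply \<open>f\<close> by a separator for \<open>W b\<close> that ignores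
  \<open>W a\<close>. The product has degree \<open>2 * s + 1\<close> and vanishes on
  \<open>Z\<close> and at every other \<open>W i\<close>, so \<open>sum_eq\<close> reduces to one
  term with nonzero weight.\<close>

lemma vanishing_spreads:
  assumes "f \<in> hform n (Suc s)" "\<And>i. i < h \<Longrightarrow> f (Z i) = 0" "f (W a) = 0" "a < h" "b < h"
  shows "f (W b) = 0"
proof (cases "a = b")
  case False
  then obtain q where q: "q \<in> hform n s" "\<And>k. k < h \<Longrightarrow> k \<noteq> b \<Longrightarrow> k \<noteq> a \<Longrightarrow> q (W k) = 0" "q (W b) \<noteq> 0"
    using W.separator[of b a] assms by metis
  have "(\<lambda>v. q v * f v) \<in> hform n (2 * s + 1)"
    using hform_mult[OF q(1) assms(1)] by (simp add: mult_2)
  from sum_eq[OF this] have "0 = (\<Sum>i<h. l' i * (q (W i) * f (W i)))"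
    using assms(2) by simp
  also have "\<dots> = (\<Sum>i<h. if i = b then l' b * (q (W b) * f (W b)) else 0)"
  proof (intro sum.cong refl)
    fix i assume "i \<in> {..<h}"
    then show "l' i * (q (W i) * f (W i)) = (if i = b then l' b * (q (W b) * f (W b)) else 0)"
      using q(2)[of i] assms(3) by (cases "i = a") auto
  qed
  also have "\<dots> = l' b * (q (W b) * f (W b))" using assms by simp
  finally show ?thesis using q(3) l'_nonzero[OF assms(5)] by simp
qed (use assms in simp)

lemma separating_form_W:
  assumes "a < h" "\<And>i. i < h \<Longrightarrow> \<nexists>t. \<forall>k\<le>n. W a k = t * Z i k"
  obtains f where "f \<in> hform n (Suc s)" "\<And>i. i < h \<Longrightarrow> f (Z i) = 0" "f (W a) \<noteq> 0"
proof -
  obtain k where "k \<le> n" "W a k \<noteq> 0" using W.point_nonzero assms(1) by blast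
  from Z.separating_form[of k "W a", OF this assms(2)] that show thesis by blast
qed

text \<open>A form through all \<open>Z i\<close> that misses \<open>W b\<close> misses every
  \<open>W a\<close> by \<open>vanishing_spreads\<close>, yet it vanishes at multiples of the
  \<open>Z i\<close>.\<close>

lemma disjoint_if_one_outside:
  assumes "b < h" "\<And>i. i < h \<Longrightarrow> \<nexists>t. \<forall>k\<le>n. W b k = t * Z i k" "a < h" "i < h"
  shows "\<nexists>t. \<forall>k\<le>n. W a k = t * Z i k"
proof
  assume "\<exists>t. \<forall>k\<le>n. W a k = t * Z i k"
  then obtain t where t: "\<And>k. k \<le> n \<Longrightarrow> W a k = t * Z i k" by blast
  obtain f where f: "f \<in> hform n (Suc s)" "\<And>i. i < h \<Longrightarrow> f (Z i) = 0" "f (W b) \<noteq> 0"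
    using separating_form_W assms(1,2) by metis
  have "f (W a) = 0" using hform_homogeneous[OF f(1) t] f(2) assms(4) by simp
  with vanishing_spreads[OF f(1,2) _ assms(3,1)] f(3) show False by blast
qed

text \<open>On forms vanishing at \<open>W a\<close>, evaluation at \<open>W b\<close> is a
  combination of the evaluations at the \<open>Z i\<close>, by \<open>vanishing_spreads\<close>. A
  \<open>Z j\<close> with nonzero coefficient lies on the line by \<open>in_span_of_residual\<close>
  with two points in \<open>E\<close>, which is where \<open>n >= 3\<close> enters.\<close>

lemma line_through_two_meets:
  assumes "n \<ge> 3" "a < h" "b < h" "a \<noteq> b"
    and out: "\<And>i. i < h \<Longrightarrow> \<nexists>t. \<forall>k\<le>n. W a k = t * Z i k"
  shows "\<exists>j<h. \<forall>f\<in>hform n 1. f (W a) = 0 \<longrightarrow> f (W b) = 0 \<longrightarrow> f (Z j) = 0"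
proof -
  obtain g where g: "g \<in> hform n (Suc s)" "\<And>i. i < h \<Longrightarrow> g (Z i) = 0" "g (W a) \<noteq> 0"
    using separating_form_W[OF assms(2) out] by metis
  obtain F where F: "\<And>i. i < h \<Longrightarrow> F i \<in> hform n (Suc s)"
    "\<And>i k. i < h \<Longrightarrow> k < h \<Longrightarrow> F i (Z k) = (if k = i then 1 else 0)"
    using Z.lagrange_basis by blast
  \<comment> \<open>Subtracting a multiple of \<open>g\<close> makes the Lagrange basis vanish at
    \<open>W a\<close> and keeps its values on \<open>Z\<close>.\<close>
  define G where "G i v = F i v - F i (W a) / g (W a) * g v" for i v
  have G: "G i \<in> hform n (Suc s)" if "i < h" for i
    unfolding G_def using that by (intro hform_diff hform_scale F g)
  have G_Z: "G i (Z k) = (if k = i then 1 else 0)" if "i < h" "k < h" for i k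
    using that F(2) g(2) by (simp add: G_def)
  have G_W: "G i (W a) = 0" for i using g(3) by (simp add: G_def)
  have expand: "f (W b) = (\<Sum>i<h. f (Z i) * G i (W b))"
    if f: "f \<in> hform n (Suc s)" "f (W a) = 0" for f
  proof -
    let ?f = "\<lambda>v. f v - (\<Sum>i<h. f (Z i) * G i v)"
    have "?f (W b) = 0"
    proof (rule vanishing_spreads[of ?f a])
      show "?f \<in> hform n (Suc s)"
        using G f by (intro hform_diff hform_sum hform_scale) auto
      show "?f (Z k) = 0" if "k < h" for k
        using that G_Z by (simp add: if_distrib[of "\<lambda>x. _ * x"] cong: if_cong)
    qed (use f G_W assms in simp_all)
    then show ?thesis by simp
  qed
  obtain c where c: "c \<in> hform n 1" "c (W a) = 0" "c (W b) \<noteq> 0"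
    using W.linear_separator[of b a] assms by metis
  have "c (W a) ^ Suc s = 0" using c(2) by simp
  from expand[OF hform_power[OF c(1)] this] have "(\<Sum>i<h. c (Z i) ^ Suc s * G i (W b)) \<noteq> 0"
    using c(3) by (metis power_not_zero)
  then obtain j where "j \<in> {..<h}" "c (Z j) ^ Suc s * G j (W b) \<noteq> 0"
    by (rule sum.not_neutral_contains_not_neutral)
  then have j: "j < h" "G j (W b) \<noteq> 0" by simp_all
  have "f (Z j) = 0" if "f \<in> hform n 1" "f (W a) = 0" "f (W b) = 0" for f
  proof (rule Z.in_span_of_residual[of "{W a, W b}"])
    fix f assume f: "f \<in> hform n (Suc s)" "\<And>p. p \<in> {W a, W b} \<Longrightarrow> f p = 0"
      "\<And>i. i < h \<Longrightarrow> i \<noteq> j \<Longrightarrow> f (Z i) = 0"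
    have "(\<Sum>i<h. f (Z i) * G i (W b)) = f (Z j) * G j (W b)"
      using f(3) j by (subst sum.remove[of _ j]) (auto intro!: sum.neutral)
    with expand[OF f(1)] f(2) j show "f (Z j) = 0" by simp
  next
    show "card {W a, W b} < n" using assms(1) card_insert_if[of "{W b}" "W a"] by simp
  qed (use that j in auto)
  with j(1) show ?thesis by blast
qed

end

section \<open>Cubic surfaces: five points in space\<close>

text \<open>A \<open>Z j\<close> on two edges of the tetrahedron \<open>W 0\<close>, ...,
  \<open>W 3\<close> has at most one nonzero barycentric coordinate, so it would be zero or
  proportional to a vertex.\<close>

lemma cubic_surface_configs:
  assumes "two_configs 3 1 5 Z W l l'" "b < 5"
  shows "\<exists>i<5. \<exists>t. \<forall>k\<le>3. W b k = t * Z i k"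
proof (rule ccontr)
  interpret two_configs 3 1 5 Z W l l' by fact
  assume "\<not> ?thesis"
  then have out: "\<nexists>t. \<forall>k\<le>3. W a k = t * Z i k" if "a < 5" "i < 5" for a i
    using disjoint_if_one_outside[OF assms(2) _ that] by blast
  define P :: "(nat \<times> nat) set" where "P = {(0,1),(0,2),(0,3),(1,2),(1,3),(2,3)}"
  have "\<exists>j. j < 5 \<and> (\<forall>f\<in>hform 3 1. f (W (fst p)) = 0 \<longrightarrow> f (W (snd p)) = 0 \<longrightarrow> f (Z j) = 0)"
    if "p \<in> P" for p
  proof -
    have "fst p < 5" "snd p < 5" "fst p \<noteq> snd p" using that by (auto simp: P_def)
    from line_through_two_meets[OF _ this out] show ?thesis using \<open>fst p < 5\<close> by simp
  qed
  then have "\<forall>p\<in>P. \<exists>j. j < 5 \<and> (\<forall>f\<in>hform 3 1. f (W (fst p)) = 0 \<longrightarrow> f (W (snd p)) = 0 \<longrightarrow> f (Z j) = 0)"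
    by (rule ballI)
  from bchoice[OF this] obtain J where
    "\<forall>p\<in>P. J p < 5 \<and> (\<forall>f\<in>hform 3 1. f (W (fst p)) = 0 \<longrightarrow> f (W (snd p)) = 0 \<longrightarrow> f (Z (J p)) = 0)" ..
  then have J: "\<And>p. p \<in> P \<Longrightarrow> J p < 5"
    "\<And>p f. p \<in> P \<Longrightarrow> f \<in> hform 3 1 \<Longrightarrow> f (W (fst p)) = 0 \<Longrightarrow> f (W (snd p)) = 0 \<Longrightarrow> f (Z (J p)) = 0"
    by simp_all
  have "card (J ` P) \<le> card {..<5::nat}" using J(1) by (intro card_mono) auto
  then have "card (J ` P) < card P" by (simp add: P_def)
  then have "\<not> inj_on J P" by (rule pigeonhole)
  then obtain p p' where p: "p \<in> P" "p' \<in> P" "p \<noteq> p'" "J p = J p'" by (auto simp: inj_on_def)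
  define j where "j = J p"
  have j: "j < 5" using J(1) p by (simp add: j_def)
  \<comment> \<open>Barycentric coordinates: linear forms dual to the four vertices, the separators
    being those that ignore \<open>W 4\<close>.\<close>
  have "\<forall>e\<in>{..<4}. \<exists>a. a \<in> hform 3 1 \<and> (\<forall>k<4. k \<noteq> e \<longrightarrow> a (W k) = 0) \<and> a (W e) \<noteq> 0"
  proof
    fix e :: nat assume "e \<in> {..<4}"
    then obtain a where "a \<in> hform 3 1" "\<And>k. k < 5 \<Longrightarrow> k \<noteq> e \<Longrightarrow> k \<noteq> 4 \<Longrightarrow> a (W k) = 0" "a (W e) \<noteq> 0"
      using W.separator[of e 4] by auto
    then show "\<exists>a. a \<in> hform 3 1 \<and> (\<forall>k<4. k \<noteq> e \<longrightarrow> a (W k) = 0) \<and> a (W e) \<noteq> 0"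
      by (intro exI[of _ a]) auto
  qed
  from bchoice[OF this] obtain a where
    a: "\<And>e. e < 4 \<Longrightarrow> a e \<in> hform 3 1" "\<And>e k. e < 4 \<Longrightarrow> k < 4 \<Longrightarrow> k \<noteq> e \<Longrightarrow> a e (W k) = 0"
      "\<And>e. e < 4 \<Longrightarrow> a e (W e) \<noteq> 0" by auto
  have a_Z: "a e (Z j) = 0" if "e < 4" "e \<notin> {fst p, snd p} \<or> e \<notin> {fst p', snd p'}" for e
  proof -
    have lt: "fst p < 4" "snd p < 4" "fst p' < 4" "snd p' < 4" using p by (auto simp: P_def)
    from that(2) show ?thesis
    proof
      assume "e \<notin> {fst p, snd p}"
      then show ?thesis using J(2)[OF p(1) a(1)[OF that(1)]] a(2) that(1) lt by (auto simp: j_def)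
    next
      assume "e \<notin> {fst p', snd p'}"
      then show ?thesis using J(2)[OF p(2) a(1)[OF that(1)]] a(2) that(1) lt p(4) by (auto simp: j_def)
    qed
  qed
  \<comment> \<open>Two distinct edges share at most one vertex; for opposite edges any
    \<open>e\<close> will do.\<close>
  have "\<exists>e<4. \<forall>e'. e' \<in> {fst p, snd p} \<and> e' \<in> {fst p', snd p'} \<longrightarrow> e' = e"
  proof -
    have lt: "fst p < snd p" "fst p' < snd p'" "snd p < 4" using p(1,2) by (auto simp: P_def)
    have "e1 = e2" if "e1 \<in> {fst p, snd p}" "e2 \<in> {fst p, snd p}"
      "e1 \<in> {fst p', snd p'}" "e2 \<in> {fst p', snd p'}" for e1 e2
      using that lt p(3) by (auto simp: prod_eq_iff)
    moreover have "e < 4" if "e \<in> {fst p, snd p}" for e using that lt by auto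
    ultimately show ?thesis by (metis zero_less_numeral)
  qed
  then obtain e where e: "e < 4" "\<And>e'. e' \<in> {fst p, snd p} \<Longrightarrow> e' \<in> {fst p', snd p'} \<Longrightarrow> e' = e"
    by blast
  have "\<nexists>t. \<forall>k\<le>3. Z j k = t * W e k"
  proof
    assume "\<exists>t. \<forall>k\<le>3. Z j k = t * W e k"
    then obtain t where t: "\<And>k. k \<le> 3 \<Longrightarrow> Z j k = t * W e k" by blast
    have "t \<noteq> 0" using Z.point_nonzero[OF j] t by auto
    then have "\<forall>k\<le>3. W e k = inverse t * Z j k" using t by simp
    with out[of e j] e j show False by auto
  qed
  moreover obtain k where "k \<le> 3" "W e k \<noteq> 0" using W.point_nonzero[of e] e by auto
  ultimately obtain f where f: "f \<in> hform 3 1" "f (W e) = 0" "f (Z j) \<noteq> 0"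
    using linear_form_separation[of k 3 "W e" "Z j"] by blast
  \<comment> \<open>\<open>f\<close> minus its expansion in the dual forms vanishes at four of the
    five points, hence everywhere. At \<open>Z j\<close> every term of the expansion is zero: the
    one for \<open>e\<close> because \<open>f (W e) = 0\<close>, the others by
    \<open>a_Z\<close>.\<close>
  let ?f = "\<lambda>v. f v - (\<Sum>e<4. f (W e) / a e (W e) * a e v)"
  have "?f (Z j) = 0"
  proof (rule W.vanishes_if_all_but_one[of ?f 4])
    show "?f \<in> hform 3 1" using a(1) f by (intro hform_diff hform_sum hform_scale) auto
    fix i :: nat assume "i < 5" "i \<noteq> 4"
    then have i: "i < 4" by simp
    have "(\<Sum>e<4. f (W e) / a e (W e) * a e (W i)) = (\<Sum>e<4. if e = i then f (W i) else 0)"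
      using a(2,3) i by (intro sum.cong) auto
    also have "\<dots> = f (W i)" using i by simp
    finally show "?f (W i) = 0" by simp
  qed simp
  moreover have "(\<Sum>e<4. f (W e) / a e (W e) * a e (Z j)) = 0"
  proof (rule sum.neutral, rule ballI)
    fix e' :: nat assume "e' \<in> {..<4}"
    then show "f (W e') / a e' (W e') * a e' (Z j) = 0"
      using e(2)[of e'] a_Z[of e'] f(2) by (cases "e' = e") auto
  qed
  ultimately show False using f(3) by simp
qed

section \<open>Plane quintics: syzygies between cubics through seven points\<close>

text \<open>A nontrivial syzygy gives \<open>G1 = a2 * g\<close> and \<open>G2 = - a1 * g\<close>
  for a conic \<open>g\<close>. Each \<open>Z i\<close> off the conic is a common zero of
  \<open>a1\<close> and \<open>a2\<close>, which is a single projective point, whereas a nonzero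
  conic misses at least two of the \<open>Z i\<close>.\<close>

lemma no_cubic_syzygy:
  assumes "point_config 2 2 7 Z"
    and a: "a1 \<in> hform 2 1" "a2 \<in> hform 2 1"
    and G: "G1 \<in> hform 2 3" "G2 \<in> hform 2 3"
    and G_Z: "\<And>i. i < 7 \<Longrightarrow> G1 (Z i) = 0" "\<And>i. i < 7 \<Longrightarrow> G2 (Z i) = 0"
    and G_nz: "G1 u \<noteq> 0" "G2 u = 0" "G2 u' \<noteq> 0"
    and syz: "\<And>v. a1 v * G1 v + a2 v * G2 v = 0"
  shows "a1 v = 0 \<and> a2 v = 0"
proof (rule ccontr)
  interpret point_config 2 2 7 Z by fact
  assume nz: "\<not> ?thesis"
  have a1_nz: "\<exists>y. a1 y \<noteq> 0"
  proof (rule ccontr)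
    assume "\<not> ?thesis"
    then have "G2 v * a2 v = 0" for v using syz[of v] by auto
    then have "a2 v = 0" by (rule hform_zero_divisor[OF G(2) a(2) _ G_nz(3)])
    with nz \<open>\<not> (\<exists>y. a1 y \<noteq> 0)\<close> show False by simp
  qed
  then obtain y where y: "a1 y \<noteq> 0" ..
  have "\<exists>x. a1 x = 0 \<and> a2 x \<noteq> 0"
  proof (rule ccontr)
    assume *: "\<nexists>x. a1 x = 0 \<and> a2 x \<noteq> 0"
    define t where "t = a2 y / a1 y"
    have a2: "a2 v = t * a1 v" for v
    proof -
      \<comment> \<open>The projection of \<open>v\<close> along \<open>y\<close> to the line
        \<open>a1 = 0\<close>.\<close>
      let ?x = "\<lambda>i. 1 * v i + (- a1 v / a1 y) * y i"
      have "a1 ?x = 0" using y by (subst hform_1_linear[OF a(1)]) simp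
      then have "a2 ?x = 0" using * by blast
      then show ?thesis using y by (subst (asm) hform_1_linear[OF a(2)]) (simp add: t_def)
    qed
    \<comment> \<open>With \<open>a2 = t * a1\<close> the syzygy becomes
      \<open>a1 * (G1 + t * G2) = 0\<close>, which fails at \<open>u\<close>, where only
      \<open>G2\<close> vanishes.\<close>
    have "(\<lambda>v. G1 v + t * G2 v) \<in> hform 2 3" by (intro hform_add hform_scale G)
    moreover have "a1 v * (G1 v + t * G2 v) = 0" for v
      using syz[of v] a2[of v] by (simp add: algebra_simps)
    ultimately have "G1 u + t * G2 u = 0" by (rule hform_zero_divisor[OF a(1) _ _ y])
    with G_nz show False by simp
  qed
  then obtain x0 where x0: "a1 x0 = 0" "a2 x0 \<noteq> 0" by blast
  \<comment> \<open>Normalized to \<open>a2 x = 1\<close>, so that \<open>?y\<close> projects along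
    \<open>x\<close> to the line \<open>a2 = 0\<close>; it preserves \<open>a1\<close> because
    \<open>a1 x = 0\<close>.\<close>
  define x where "x i = inverse (a2 x0) * x0 i" for i
  have x: "a1 x = 0" "a2 x = 1"
    using hform_homogeneous[OF a(1), of x "inverse (a2 x0)" x0]
      hform_homogeneous[OF a(2), of x "inverse (a2 x0)" x0] x0 by (simp_all add: x_def)
  let ?y = "\<lambda>v i. v i - a2 v * x i"
  have "G1 \<in> hform 2 (Suc 2)" using G(1) by simp
  from hform_division[OF this a(2), of x]
  obtain g where g: "g \<in> hform 2 2" "\<And>v. G1 v = G1 (?y v) + a2 v * g v" by blast
  have "(\<lambda>v. ?y v i) \<in> hform 2 1" if "i \<le> 2" for i
    using hform_diff[OF hform_var[OF that] hform_scale[OF a(2), of "x i"]] by (simp add: mult.commute)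
  then have h: "(\<lambda>v. G1 (?y v)) \<in> hform 2 3" by (rule hform_subst[OF G(1)])
  \<comment> \<open>On \<open>a2 = 0\<close> only the first term of the syzygy remains, so the
    remainder of \<open>G1\<close> on division by \<open>a2\<close> is zero.\<close>
  have "a1 v * G1 (?y v) = 0" for v
  proof -
    have "a1 (?y v) = a1 v" "a2 (?y v) = 0"
      using hform_1_linear[OF a(1), of 1 v "- a2 v" x] hform_1_linear[OF a(2), of 1 v "- a2 v" x] x
      by simp_all
    with syz[of "?y v"] show ?thesis by simp
  qed
  then have "G1 (?y v) = 0" for v by (rule hform_zero_divisor[OF a(1) h _ y])
  then have G1: "G1 v = a2 v * g v" for v using g(2)[of v] by simp
  have "(\<lambda>v. a1 v * g v + G2 v) \<in> hform 2 3"
    using hform_add[OF hform_mult[OF a(1) g(1)], of G2] G(2) by (simp add: numeral_3_eq_3)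
  moreover have "a2 v * (a1 v * g v + G2 v) = 0" for v
    using syz[of v] G1[of v] by (simp add: algebra_simps)
  ultimately have G2: "a1 v * g v + G2 v = 0" for v
    by (rule hform_zero_divisor[OF a(2) _ _ x0(2)])
  have base: "a1 (Z i) = 0 \<and> a2 (Z i) = 0" if "i < 7" "g (Z i) \<noteq> 0" for i
    using G1[of "Z i"] G2[of "Z i"] G_Z that by simp
  have "\<exists>i<7. g (Z i) \<noteq> 0"
  proof (rule ccontr)
    assume "\<not> ?thesis"
    then have "g (Z i) = 0" if "i < 7" for i using that by blast
    then have "g u = 0" by (rule vanishes_if_all_but_one[OF g(1) zero_less_numeral])
    with G1[of u] G_nz show False by simp
  qed
  then obtain i where i: "i < 7" "g (Z i) \<noteq> 0" by blast
  have "\<exists>k<7. k \<noteq> i \<and> g (Z k) \<noteq> 0"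
  proof (rule ccontr)
    assume "\<not> ?thesis"
    then have "g (Z k) = 0" if "k < 7" "k \<noteq> i" for k using that by blast
    then have "g u = 0" by (rule vanishes_if_all_but_one[OF g(1) i(1)])
    with G1[of u] G_nz show False by simp
  qed
  then obtain k where k: "k < 7" "k \<noteq> i" "g (Z k) \<noteq> 0" by blast
  obtain b1 where b1: "b1 \<in> hform 2 1" "b1 (Z i) = 0" "b1 (Z k) \<noteq> 0"
    using linear_separator[of k i] i k by metis
  obtain b2 where b2: "b2 \<in> hform 2 1" "b2 (Z k) = 0" "b2 (Z i) \<noteq> 0"
    using linear_separator[of i k] i k by metis
  \<comment> \<open>Four linear forms in three variables are dependent, but evaluating the relation
    at \<open>Z i\<close>, \<open>Z k\<close>, \<open>x\<close> and \<open>y\<close> in turn kills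
    all coefficients.\<close>
  define A where "A = (\<lambda>j::nat. if j = 0 then a1 else if j = 1 then a2 else if j = 2 then b1 else b2)"
  have "card (words 2 1) < card {..<4::nat}"
    unfolding card_words by code_simp
  moreover have "A j \<in> hform 2 1" for j using a b1 b2 by (simp add: A_def)
  ultimately obtain c where c: "\<exists>j\<in>{..<4::nat}. c j \<noteq> 0" "\<forall>v. (\<Sum>j<4. c j * A j v) = 0"
    using hform_dependent[OF finite_lessThan, of 2 1 4 A] by blast
  have c2: "c 0 * a1 v + c 1 * a2 v + c 2 * b1 v + c 3 * b2 v = 0" for v
    using c(2)[rule_format, of v] by (simp add: A_def eval_nat_numeral)
  have "c 3 = 0" using c2[of "Z i"] base[OF i] b1 b2 by simp
  moreover have "c 2 = 0" using c2[of "Z k"] base[of k] k b1 b2 by simp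
  moreover have "c 1 = 0" using c2[of x] x calculation by simp
  moreover have "c 0 = 0" using c2[of y] y calculation by simp
  moreover have "{..<4::nat} = {0, 1, 2, 3}" by auto
  ultimately show False using c(1) by simp
qed

text \<open>Of two separators for \<open>Z i\<close> that ignore different points, each vanishes at
  the point ignored by the other. For \<open>s = 2\<close> the seven points thus impose independent
  conditions on quartics.\<close>

lemma (in point_config) quadratic_lagrange_basis:
  obtains S where "\<And>i. i < h \<Longrightarrow> S i \<in> hform n (s + s)"
    "\<And>i k. i < h \<Longrightarrow> k < h \<Longrightarrow> k \<noteq> i \<Longrightarrow> S i (Z k) = 0" "\<And>i. i < h \<Longrightarrow> S i (Z i) \<noteq> 0"
proof -
  have "\<exists>f. f \<in> hform n (s + s) \<and> (\<forall>k<h. k \<noteq> i \<longrightarrow> f (Z k) = 0) \<and> f (Z i) \<noteq> 0" if i: "i < h" for i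
  proof -
    obtain j where j: "j < h" "j \<noteq> i" using third_index by blast
    obtain k where k: "k < h" "k \<noteq> i" "k \<noteq> j" using third_index by blast
    obtain q where q: "q \<in> hform n s" "\<And>m. m < h \<Longrightarrow> m \<noteq> i \<Longrightarrow> m \<noteq> j \<Longrightarrow> q (Z m) = 0" "q (Z i) \<noteq> 0"
      using separator[of i j] i j by metis
    obtain q' where q': "q' \<in> hform n s" "\<And>m. m < h \<Longrightarrow> m \<noteq> i \<Longrightarrow> m \<noteq> k \<Longrightarrow> q' (Z m) = 0" "q' (Z i) \<noteq> 0"
      using separator[of i k] i k by metis
    have "q (Z m) * q' (Z m) = 0" if "m < h" "m \<noteq> i" for m
      using q(2)[OF that] q'(2)[OF that] k(3) by (cases "m = j") simp_all
    then show ?thesis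
      using hform_mult[OF q(1) q'(1)] q(3) q'(3) by (intro exI[of _ "\<lambda>v. q v * q' v"]) simp
  qed
  then have "\<forall>i\<in>{..<h}. \<exists>f. f \<in> hform n (s + s) \<and> (\<forall>k<h. k \<noteq> i \<longrightarrow> f (Z k) = 0) \<and> f (Z i) \<noteq> 0"
    by simp
  from bchoice[OF this] obtain S where
    "\<forall>i\<in>{..<h}. S i \<in> hform n (s + s) \<and> (\<forall>k<h. k \<noteq> i \<longrightarrow> S i (Z k) = 0) \<and> S i (Z i) \<noteq> 0" ..
  then show thesis by (intro that[of S]) simp_all
qed

text \<open>Three independent cubics through seven general points satisfy a linear syzygy
  \<open>\<Sum> a\<^sub>j A\<^sub>j = 0\<close>, because the nine products \<open>x\<^sub>i A\<^sub>j\<close> lie in the eight-dimensional space of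
  quartics through the points. Hence the fibres of the map \<open>(A\<^sub>0 : A\<^sub>1 : A\<^sub>2)\<close> are collinear,
  while \<open>vanishing_spreads\<close> puts all points of \<open>W\<close> into a single fibre.\<close>

lemma plane_quintic_configs:
  assumes "two_configs 2 2 7 Z W l l'" "b < 7"
  shows "\<exists>i<7. \<exists>t. \<forall>k\<le>2. W b k = t * Z i k"
proof (rule ccontr)
  interpret two_configs 2 2 7 Z W l l' by fact
  assume "\<not> ?thesis"
  then have "\<And>i. i < 7 \<Longrightarrow> \<nexists>t. \<forall>k\<le>2. W b k = t * Z i k" by blast
  from separating_form_W[OF assms(2) this]
  obtain A0 where A0: "A0 \<in> hform 2 (Suc 2)" "\<And>i. i < 7 \<Longrightarrow> A0 (Z i) = 0" "A0 (W b) \<noteq> 0"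
    by metis
  have A0_W: "A0 (W k) \<noteq> 0" if "k < 7" for k
    using vanishing_spreads[OF A0(1,2) _ that assms(2)] A0(3) by blast
  let ?S = "insert (W b) (Z ` {..<7})"
  have "card (Z ` {..<7::nat}) \<le> 7" using card_image_le[of "{..<7::nat}" Z] by simp
  then have S: "finite ?S" "card ?S \<le> 8" by (simp_all add: card_insert_if)
  then have "card ?S \<le> 9" by simp
  from ternary_cubic_vanishing[OF S(1) this] obtain G1 u where
    G1: "G1 \<in> hform 2 3" "\<forall>p\<in>?S. G1 p = 0" "G1 u \<noteq> 0" by blast
  \<comment> \<open>The extra zero at \<open>u\<close> makes \<open>G2\<close> independent of
    \<open>G1\<close>.\<close>
  have "card (insert u ?S) \<le> 9" "finite (insert u ?S)" using S by (simp_all add: card_insert_if)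
  from ternary_cubic_vanishing[OF this(2,1)] obtain G2 u' where
    G2: "G2 \<in> hform 2 3" "\<forall>p\<in>insert u ?S. G2 p = 0" "G2 u' \<noteq> 0" by blast
  have G_W: "G1 (W k) = 0" "G2 (W k) = 0" if "k < 7" for k
    using vanishing_spreads[of G1 b k] vanishing_spreads[of G2 b k] G1 G2 assms(2) that by simp_all
  define A where "A = (\<lambda>j::nat. if j = 0 then A0 else if j = 1 then G1 else G2)"
  have A: "A j \<in> hform 2 3" "i < 7 \<Longrightarrow> A j (Z i) = 0" for i j
    using A0 G1 G2 by (simp_all add: A_def)
  obtain S where S: "\<And>i. i < 7 \<Longrightarrow> S i \<in> hform 2 4"
    "\<And>i k. i < 7 \<Longrightarrow> k < 7 \<Longrightarrow> k \<noteq> i \<Longrightarrow> S i (Z k) = 0" "\<And>i. i < 7 \<Longrightarrow> S i (Z i) \<noteq> 0"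
    using Z.quadratic_lagrange_basis by (auto simp: numeral_eq_Suc)
  \<comment> \<open>Nine products and seven forms \<open>S i\<close> are sixteen quartics in a space
    of dimension fifteen; evaluation at the \<open>Z k\<close> then removes the \<open>S i\<close>
    from the relation.\<close>
  define F where "F = case_sum (\<lambda>(i, j) v. v i * A j v) S"
  define I :: "(nat \<times> nat + nat) set" where "I = ({..<3} \<times> {..<3}) <+> {..<7}"
  have "card (words 2 4) < card I"
  proof -
    have "card (words 2 4) = 15" unfolding card_words by code_simp
    then show ?thesis by (simp add: I_def card_Plus)
  qed
  moreover have "F x \<in> hform 2 4" if "x \<in> I" for x
  proof -
    have "(\<lambda>v. v i * A j v) \<in> hform 2 4" if "i < 3" for i j
      using hform_mult[OF hform_var A(1), of i j] that by simp
    then show ?thesis using that S(1) by (auto simp: I_def F_def)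
  qed
  moreover have "finite I" by (simp add: I_def)
  ultimately obtain c where c: "\<exists>x\<in>I. c x \<noteq> 0" "\<forall>v. (\<Sum>x\<in>I. c x * F x v) = 0"
    using hform_dependent[of I 2 4 F] by blast
  define a where "a j v = (\<Sum>i<3. c (Inl (i, j)) * v i)" for j v
  have a: "a j \<in> hform 2 1" for j
    unfolding a_def by (intro hform_sum hform_scale hform_var) auto
  have rel: "(\<Sum>j<3. a j v * A j v) + (\<Sum>i<7. c (Inr i) * S i v) = 0" for v
  proof -
    have "(\<Sum>x\<in>I. c x * F x v)
        = (\<Sum>(i, j)\<in>{..<3} \<times> {..<3}. c (Inl (i, j)) * (v i * A j v)) + (\<Sum>i<7. c (Inr i) * S i v)"
      by (simp add: I_def sum.Plus F_def case_prod_unfold)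
    also have "(\<Sum>(i, j)\<in>{..<3} \<times> {..<3}. c (Inl (i, j)) * (v i * A j v)) = (\<Sum>j<3. a j v * A j v)"
      unfolding a_def sum_distrib_right
      by (subst sum.cartesian_product[symmetric], subst sum.swap) (simp add: mult.assoc)
    finally show ?thesis using c(2) by simp
  qed
  have c_Inr: "c (Inr k) = 0" if k: "k < 7" for k
  proof -
    have "(\<Sum>i<7. c (Inr i) * S i (Z k)) = (\<Sum>i<7. if i = k then c (Inr k) * S k (Z k) else 0)"
      using S(2) k by (intro sum.cong) auto
    then have "c (Inr k) * S k (Z k) = 0" using rel[of "Z k"] A(2) k by simp
    then show ?thesis using S(3) k by simp
  qed
  have syz: "a 0 v * A0 v + a 1 v * G1 v + a 2 v * G2 v = 0" for v
    using rel[of v] c_Inr by (simp add: A_def eval_nat_numeral)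
  \<comment> \<open>At \<open>W k\<close> only \<open>A0\<close> among the three cubics is
    nonzero.\<close>
  have "a 0 (W k) = 0" if "k < 7" for k
    using syz[of "W k"] G_W[OF that] A0_W[OF that] by simp
  then have a0: "a 0 v = 0" for v by (rule W.no_hyperplane[OF a])
  have "a 1 v = 0 \<and> a 2 v = 0" for v
    by (rule no_cubic_syzygy[OF Z.point_config_axioms a a G1(1) G2(1) _ _ G1(3) _ G2(3)])
      (use G1 G2 syz a0 in auto)
  then have a_0: "a j v = 0" if "j < 3" for j v
    using a0 that by (auto simp: less_Suc_eq numeral_3_eq_3 numeral_2_eq_2)
  have "c (Inl (i, j)) = 0" if "i < 3" "j < 3" for i j
  proof -
    have "a j (\<lambda>k. if k = i then 1 else 0) = c (Inl (i, j))"
      using that by (simp add: a_def if_distrib[of "\<lambda>x. _ * x"] cong: if_cong)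
    then show ?thesis using a_0 that by simp
  qed
  with c_Inr c(1) show False by (auto simp: I_def)
qed

section \<open>From decompositions to point configurations\<close>

lemma smult_zero_left [simp]: "smult 0 F = 0"
  by (simp add: smult_def)

lemma power_smult: "smult c F ^ d = smult (c ^ d) (F ^ d)"
proof (induction d)
  case (Suc d)
  then show ?case by (simp add: smult_mult_left smult_mult_right)
qed simp

lemma independent_family_coeff_zero:
  assumes "finite A" "inj_on f A" "mpoly.independent (f ` A)"
    "(\<Sum>i\<in>A. smult (c i) (f i)) = 0" "i \<in> A"
  shows "c i = 0"
proof -
  let ?u = "\<lambda>v. c (the_inv_into A f v)"
  have "(\<Sum>v\<in>f ` A. smult (?u v) v) = (\<Sum>i\<in>A. smult (c i) (f i))"
    using assms(2) by (subst sum.reindex) (auto simp: the_inv_into_f_f)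
  then have "?u (f i) = 0"
    using mpoly.independentD[OF assms(3), of "f ` A" ?u "f i"] assms by auto
  then show ?thesis using assms(2,5) by (simp add: the_inv_into_f_f)
qed

lemma decomp_forms: "rank1_decomp n d h F l L \<Longrightarrow> i < h \<Longrightarrow> L i \<in> forms n 1"
  by (simp add: rank1_decomp_def)

lemma decomp_power_nonzero:
  assumes "rank1_decomp n d h F l L" "i < h"
  shows "L i ^ d \<noteq> 0"
proof
  assume "L i ^ d = 0"
  then have "0 \<in> (\<lambda>i. L i ^ d) ` {..<h}" using assms(2) by (metis imageI lessThan_iff)
  then show False using assms(1) mpoly.dependent_zero by (auto simp: rank1_decomp_def)
qed

lemma decomp_not_multiple:
  assumes "rank1_decomp n d h F l L" "i < h" "j < h" "i \<noteq> j"
  shows "L i \<noteq> smult t (L j)"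
proof
  assume "L i = smult t (L j)"
  then have eq: "L i ^ d = smult (t ^ d) (L j ^ d)" by (simp add: power_smult)
  let ?P = "(\<lambda>i. L i ^ d) ` {..<h}"
  have "L i ^ d \<noteq> L j ^ d"
    using assms by (auto simp: rank1_decomp_def inj_on_def)
  then have "L j ^ d \<in> ?P - {L i ^ d}" using assms(3) by auto
  then have "L i ^ d \<in> mpoly.span (?P - {L i ^ d})"
    unfolding eq[symmetric] by (subst eq) (intro mpoly.span_scale mpoly.span_base)
  moreover have "L i ^ d \<in> ?P" using assms(2) by auto
  ultimately have "mpoly.dependent ?P" unfolding mpoly.dependent_def by blast
  then show False using assms(1) by (simp add: rank1_decomp_def)
qed

lemma decomp_not_proportional:
  assumes "rank1_decomp n d h F l L" "i < h" "j < h" "i \<noteq> j"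
  shows "\<nexists>t. \<forall>k\<le>n. coord (L i) k = t * coord (L j) k"
  using forms_1_eq_smult[OF decomp_forms[OF assms(1,3)] decomp_forms[OF assms(1,2)]]
    decomp_not_multiple[OF assms] by blast

lemma decomp_coord_nonzero:
  assumes "rank1_decomp n d h F l L" "i < h" "d > 0"
  shows "\<exists>k\<le>n. coord (L i) k \<noteq> 0"
proof (rule ccontr)
  assume "\<not> ?thesis"
  then have "L i = smult 0 (L i)"
    using decomp_forms[OF assms(1,2)] by (intro forms_1_eq_smult[of "L i" n]) auto
  then have "L i = 0" by simp
  then have "L i ^ d = 0" using assms(3) by (simp add: power_0_left)
  with decomp_power_nonzero[OF assms(1,2)] show False ..
qed

lemma decomp_foldr_partial:
  assumes "rank1_decomp n d h F l L" "set js \<subseteq> {..n}" "length js \<le> d"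
  shows "foldr partial js F = smult (fact d / fact (d - length js))
    (\<Sum>i<h. smult (l i * mon js (coord (L i))) (L i ^ (d - length js)))"
  using partials_power_sum[of h L n js d l] assms by (simp add: rank1_decomp_def)

text \<open>A derivative of full order \<open>d\<close> is a constant determined by
  \<open>F\<close>: \<open>fact d\<close> times the weighted sum of the values of its
  monomial.\<close>

lemma decomp_sum_eq:
  assumes "rank1_decomp n d h F l L" "rank1_decomp n d h F l' L'" "g \<in> hform n d"
  shows "(\<Sum>i<h. l i * g (coord (L i))) = (\<Sum>i<h. l' i * g (coord (L' i)))"
  using assms(3)
proof (induction rule: hform_induct)
  case (mon js)
  have *: "Poly_Mapping.lookup (foldr partial js F) 0 = fact d * (\<Sum>i<h. l i * mon js (coord (L i)))"
    if "rank1_decomp n d h F l L" for l L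
  proof -
    have "foldr partial js F = smult (fact d) (\<Sum>i<h. smult (l i * mon js (coord (L i))) 1)"
      using decomp_foldr_partial[OF that] mon by simp
    then show ?thesis
      by (simp add: smult_def sum_distrib_left mult_single lookup_sum lookup_single)
  qed
  have "fact d * (\<Sum>i<h. l i * mon js (coord (L i))) = fact d * (\<Sum>i<h. l' i * mon js (coord (L' i)))"
    using *[OF assms(1)] *[OF assms(2)] by simp
  then show ?case by simp
next
  case (scale c f)
  have "(\<Sum>i<h. l i * (c * f (coord (L i)))) = c * (\<Sum>i<h. l i * f (coord (L i)))" for l L
    by (simp add: sum_distrib_left mult.left_commute)
  with scale show ?case by simp
qed (simp_all add: distrib_left sum.distrib)

text \<open>Proportionality gives a map of indices, injective because no two of the
  \<open>L' b\<close> are multiples of each other. Independence of the powers of the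
  \<open>L i\<close> then makes the coefficients match.\<close>

lemma same_decomp_if_proportional:
  assumes "rank1_decomp n d h F l L" "rank1_decomp n d h F l' L'" "d > 0"
    and "\<And>b. b < h \<Longrightarrow> \<exists>i<h. \<exists>t. \<forall>k\<le>n. coord (L' b) k = t * coord (L i) k"
  shows "same_decomp d h l L l' L'"
proof -
  have "\<exists>i t. i < h \<and> L' b = smult t (L i)" if "b < h" for b
    using assms(4)[OF that] forms_1_eq_smult[OF decomp_forms[OF assms(1)] decomp_forms[OF assms(2) that]]
    by metis
  then obtain \<sigma> t where \<sigma>: "\<And>b. b < h \<Longrightarrow> \<sigma> b < h" "\<And>b. b < h \<Longrightarrow> L' b = smult (t b) (L (\<sigma> b))"
    by metis
  have t: "t b \<noteq> 0" if "b < h" for b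
    using \<sigma>(2)[OF that] decomp_power_nonzero[OF assms(2) that] assms(3) by (auto simp: power_0_left)
  have inj: "inj_on \<sigma> {..<h}"
  proof (rule inj_onI, rule ccontr)
    fix b b' assume b: "b \<in> {..<h}" "b' \<in> {..<h}" "\<sigma> b = \<sigma> b'" "b \<noteq> b'"
    then have "L' b = smult (t b / t b') (L' b')"
      using \<sigma>(2)[of b] \<sigma>(2)[of b'] t[of b'] by simp
    with decomp_not_multiple[OF assms(2), of b b'] b show False by blast
  qed
  have bij: "bij_betw \<sigma> {..<h} {..<h}"
    using inj \<sigma>(1) by (intro bij_betw_imageI endo_inj_surj) auto
  define p where "p i = (if i < h then \<sigma> i else i)" for i
  have "bij_betw p {..<h} {..<h}" using bij by (subst bij_betw_cong[of _ _ \<sigma>]) (simp_all add: p_def)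
  then have p: "p permutes {..<h}" by (rule bij_imp_permutes) (simp add: p_def)
  \<comment> \<open>\<open>m\<close> carries the coefficients of the second decomposition over to
    the powers of the \<open>L i\<close>.\<close>
  define m where "m i = l' (the_inv_into {..<h} \<sigma> i) * t (the_inv_into {..<h} \<sigma> i) ^ d" for i
  have m: "m (\<sigma> b) = l' b * t b ^ d" if "b < h" for b
    using inj that by (simp add: m_def the_inv_into_f_f)
  have "(\<Sum>i<h. smult (m i) (L i ^ d)) = (\<Sum>b<h. smult (m (\<sigma> b)) (L (\<sigma> b) ^ d))"
    by (rule sum.reindex_bij_betw[OF bij, symmetric])
  also have "\<dots> = (\<Sum>b<h. smult (l' b) (L' b ^ d))"
    using \<sigma>(2) m by (intro sum.cong) (simp_all add: power_smult)
  also have "\<dots> = (\<Sum>i<h. smult (l i) (L i ^ d))"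
    using assms(1,2) by (simp add: rank1_decomp_def)
  finally have "(\<Sum>i<h. smult (m i - l i) (L i ^ d)) = 0"
    by (simp add: mpoly.scale_left_diff_distrib sum_subtractf)
  then have "m i - l i = 0" if "i < h" for i
    using independent_family_coeff_zero[of "{..<h}" "\<lambda>i. L i ^ d" "\<lambda>i. m i - l i" i] assms(1) that
    by (simp add: rank1_decomp_def)
  then have "l' b * t b ^ d = l (\<sigma> b)" if "b < h" for b using m[OF that] \<sigma>(1)[OF that] by simp
  then show ?thesis
    unfolding same_decomp_def using p t \<sigma>(2) by (intro exI[of _ p] exI[of _ t]) (simp add: p_def)
qed

section \<open>Binary forms\<close>

text \<open>With \<open>h\<close> linear factors killing the first points and \<open>h - 1\<close>
  killing the second ones except the one for \<open>b\<close>, a product of degree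
  \<open>2 * h - 1\<close> would isolate that point, against \<open>decomp_sum_eq\<close>.\<close>

lemma binary_form_points:
  assumes "rank1_decomp 1 (2 * h - 1) h F l L" "rank1_decomp 1 (2 * h - 1) h F l' L'" "b < h"
  shows "\<exists>i<h. \<exists>t. \<forall>k\<le>1. coord (L' b) k = t * coord (L i) k"
proof (rule ccontr)
  assume out: "\<not> ?thesis"
  \<comment> \<open>The determinant of \<open>p\<close> and \<open>v\<close>; for nonzero
    \<open>p\<close> its zeros are the multiples of \<open>p\<close>.\<close>
  define D where "D p v = p 0 * v 1 - p 1 * v 0" for p v :: "nat \<Rightarrow> complex"
  have D: "D p \<in> hform 1 1" for p
    unfolding D_def by (intro hform_diff hform_scale hform_var) auto
  have D_self: "D p p = 0" for p by (simp add: D_def)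
  have D_nz: "D p v \<noteq> 0" if p: "\<exists>k\<le>1. p k \<noteq> 0" and v: "\<nexists>t. \<forall>k\<le>1. v k = t * p k" for p v
  proof
    assume 0: "D p v = 0"
    have le1: "k \<le> 1 \<longleftrightarrow> k = 0 \<or> k = 1" for k :: nat by auto
    from p have "p 0 \<noteq> 0 \<or> p 1 \<noteq> 0" unfolding le1 by blast
    then have "\<exists>t. v 0 = t * p 0 \<and> v 1 = t * p 1"
    proof
      assume "p 0 \<noteq> 0"
      then show ?thesis using 0 by (intro exI[of _ "v 0 / p 0"]) (auto simp: D_def field_simps)
    next
      assume "p 1 \<noteq> 0"
      then show ?thesis using 0 by (intro exI[of _ "v 1 / p 1"]) (auto simp: D_def field_simps)
    qed
    then obtain t where "v 0 = t * p 0" "v 1 = t * p 1" by blast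
    then have "\<forall>k\<le>1. v k = t * p k" unfolding le1 by auto
    with v show False by blast
  qed
  let ?Z = "\<lambda>i. coord (L i)" and ?W = "\<lambda>i. coord (L' i)"
  define g where "g v = (\<Prod>i<h. D (?Z i) v) * (\<Prod>k\<in>{..<h} - {b}. D (?W k) v)" for v
  have "g \<in> hform 1 (card {..<h} + card ({..<h} - {b}))"
    unfolding g_def by (intro hform_mult hform_prod D) auto
  then have g: "g \<in> hform 1 (2 * h - 1)" using assms(3) by (simp add: mult_2)
  have "g (?Z i) = 0" if "i < h" for i
    using that D_self by (auto simp: g_def)
  moreover have g_W: "g (?W i) = 0" if "i < h" "i \<noteq> b" for i
    using that D_self by (auto simp: g_def)
  ultimately have "0 = (\<Sum>i<h. l' i * g (?W i))"
    using decomp_sum_eq[OF assms(1,2) g] by simp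
  also have "\<dots> = (\<Sum>i<h. if i = b then l' b * g (?W b) else 0)"
    using g_W by (intro sum.cong) auto
  also have "\<dots> = l' b * g (?W b)" using assms(3) by simp
  finally have "g (?W b) = 0" using assms(2,3) by (simp add: rank1_decomp_def)
  moreover have "D (?Z i) (?W b) \<noteq> 0" if "i < h" for i
    using out that assms(3) by (intro D_nz decomp_coord_nonzero[OF assms(1)]) auto
  moreover have "D (?W k) (?W b) \<noteq> 0" if "k < h" "k \<noteq> b" for k
    using that assms(3)
    by (intro D_nz decomp_coord_nonzero[OF assms(2)] decomp_not_proportional[OF assms(2)]) auto
  ultimately show False by (auto simp: g_def)
qed

section \<open>Using the hypotheses on the span of the partial derivatives\<close>

text \<open>Symmetry of iterated derivatives is read off from the decomposition, where the order of
  \<open>js\<close> enters only through \<open>mon js\<close>.\<close>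

lemma foldr_partial_sort:
  assumes "rank1_decomp n d h F l L" "set js \<subseteq> {..n}" "length js \<le> d"
  shows "foldr partial (sort js) F = foldr partial js F"
  using decomp_foldr_partial[OF assms] decomp_foldr_partial[OF assms(1), of "sort js"] assms(2,3)
  by (simp add: mon_sort)

text \<open>By \<open>dim\<close> the span has dimension equal to the number of words; a nontrivial
  relation would let the derivatives for all words but one generate it.\<close>

lemma partials_relation_trivial:
  assumes decomp: "rank1_decomp n d h F l L" and "s \<le> d"
    and dim: "proj_dim (H_partial n s F) = int (card (words n s)) - 1"
    and rel: "(\<Sum>js\<in>words n s. smult (c js) (foldr partial js F)) = 0" and js0: "js0 \<in> words n s"
  shows "c js0 = 0"
proof (rule ccontr)
  assume nz: "c js0 \<noteq> 0"
  let ?D = "\<lambda>js. foldr partial js F"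
  let ?B = "?D ` (words n s - {js0})"
  have "smult (c js0) (?D js0) = - (\<Sum>js\<in>words n s - {js0}. smult (c js) (?D js))"
    using rel js0 by (simp add: sum.remove eq_neg_iff_add_eq_0)
  then have "?D js0 = smult (- inverse (c js0)) (\<Sum>js\<in>words n s - {js0}. smult (c js) (?D js))"
    using nz by (metis (no_types, lifting) mpoly.scale_minus_left mpoly.scale_minus_right
        mpoly.scale_one mpoly.scale_scale left_inverse)
  also have "\<dots> \<in> mpoly.span ?B"
    by (intro mpoly.span_scale mpoly.span_sum mpoly.span_base) auto
  finally have D: "?D js \<in> mpoly.span ?B" if "js \<in> words n s" for js
    using that by (cases "js = js0") (auto intro: mpoly.span_base)
  have "partials n s F \<subseteq> mpoly.span ?B"
  proof
    fix G assume "G \<in> partials n s F"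
    then obtain js where js: "G = ?D js" "length js = s" "set js \<subseteq> {..n}" by (auto simp: partials_def)
    then have "G = ?D (sort js)" using foldr_partial_sort[OF decomp] assms(2) by simp
    moreover have "sort js \<in> words n s" using js by (simp add: words_def)
    ultimately show "G \<in> mpoly.span ?B" using D by simp
  qed
  then have "mpoly.span (partials n s F) \<subseteq> mpoly.span ?B"
    by (intro mpoly.span_minimal mpoly.subspace_span)
  moreover have "\<Union>(H_partial n s F) \<subseteq> mpoly.span (partials n s F)"
  proof
    fix x assume "x \<in> \<Union>(H_partial n s F)"
    then obtain G where G: "G \<in> mpoly.span (partials n s F)" "x \<in> mpoly.span {G}"
      unfolding H_partial_def proj_space_def by blast
    then have "mpoly.span {G} \<subseteq> mpoly.span (partials n s F)"
      by (intro mpoly.span_minimal mpoly.subspace_span) simp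
    with G(2) show "x \<in> mpoly.span (partials n s F)" ..
  qed
  ultimately have "\<Union>(H_partial n s F) \<subseteq> mpoly.span ?B" by blast
  then have "mpoly.dim (\<Union>(H_partial n s F)) \<le> card ?B" by (rule mpoly.dim_le_card) simp
  also have "\<dots> \<le> card (words n s - {js0})" by (rule card_image_le) simp
  also have "\<dots> < card (words n s)" using js0 by (intro psubset_card_mono) auto
  finally show False using dim by (simp add: proj_dim_def)
qed

text \<open>Read \<open>c\<close> as an operator with symbol \<open>q\<close>. Applied to
  \<open>F\<close> it leaves only a multiple of a power of \<open>L j\<close>, with factor
  \<open>q (coord (L j))\<close>. By \<open>disj\<close> that factor is zero, and then
  \<open>partials_relation_trivial\<close> gives \<open>c = 0\<close>.\<close>

lemma point_config_of_decomp:
  assumes decomp: "rank1_decomp n d h F l L" and "n \<ge> 2" "s \<ge> 1" "h \<ge> 3" "s \<le> d"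
    and card: "Suc (card (words n s)) = h"
    and dim: "proj_dim (H_partial n s F) = int (card (words n s)) - 1"
    and disj: "H_partial n s F \<inter> veronese n (d - s) = {}"
  shows "point_config n s h (\<lambda>i. coord (L i))"
proof
  fix c j js0
  assume j: "j < h" and js0: "js0 \<in> words n s"
    and van: "\<And>i. i < h \<Longrightarrow> i \<noteq> j \<Longrightarrow> (\<Sum>js\<in>words n s. c js * mon js (coord (L i))) = 0"
  define q where "q v = (\<Sum>js\<in>words n s. c js * mon js v)" for v
  let ?K = "fact d / fact (d - s) :: complex"
  have "(\<Sum>js\<in>words n s. smult (c js) (foldr partial js F)) = (\<Sum>js\<in>words n s. \<Sum>i<h.
      smult (?K * l i) (smult (c js * mon js (coord (L i))) (L i ^ (d - s))))"
    using assms(5) by (intro sum.cong refl)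
      (auto simp: decomp_foldr_partial[OF decomp] words_def mpoly.scale_sum_right mult_ac)
  also have "\<dots> = (\<Sum>i<h. smult (?K * l i) (smult (q (coord (L i))) (L i ^ (d - s))))"
    by (subst sum.swap) (simp only: q_def mpoly.scale_sum_left mpoly.scale_sum_right)
  also have "\<dots> = (\<Sum>i<h. if i = j then smult (?K * l j * q (coord (L j))) (L j ^ (d - s)) else 0)"
    using van by (intro sum.cong) (auto simp: q_def)
  also have "\<dots> = smult (?K * l j * q (coord (L j))) (L j ^ (d - s))" using j by simp
  finally have rel: "(\<Sum>js\<in>words n s. smult (c js) (foldr partial js F))
      = smult (?K * l j * q (coord (L j))) (L j ^ (d - s))" .
  have "q (coord (L j)) = 0"
  proof (rule ccontr)
    assume q: "q (coord (L j)) \<noteq> 0"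
    define r where "r = ?K * l j * q (coord (L j))"
    have r: "r \<noteq> 0" using q decomp j by (simp add: r_def rank1_decomp_def)
    have "(\<Sum>js\<in>words n s. smult (c js) (foldr partial js F)) \<in> mpoly.span (partials n s F)"
      by (intro mpoly.span_sum mpoly.span_scale mpoly.span_base) (auto simp: words_def partials_def)
    then have "smult (inverse r) (smult r (L j ^ (d - s))) \<in> mpoly.span (partials n s F)"
      unfolding rel r_def by (rule mpoly.span_scale)
    then have "L j ^ (d - s) \<in> mpoly.span (partials n s F)" using r by simp
    moreover have "L j ^ (d - s) \<noteq> 0"
    proof
      assume "L j ^ (d - s) = 0"
      moreover have "L j ^ d = L j ^ (d - s) * L j ^ s" using assms(5) by (simp add: power_add[symmetric])
      ultimately show False using decomp_power_nonzero[OF decomp j] by simp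
    qed
    ultimately have "mpoly.span {L j ^ (d - s)} \<in> H_partial n s F"
      unfolding H_partial_def proj_space_def by blast
    moreover have "L j \<noteq> 0"
      using decomp_power_nonzero[OF decomp j] assms(3,5) by (auto simp: power_0_left)
    then have "mpoly.span {L j ^ (d - s)} \<in> veronese n (d - s)"
      unfolding veronese_def using decomp_forms[OF decomp j] by blast
    ultimately show False using disj by blast
  qed
  then have "(\<Sum>js\<in>words n s. smult (c js) (foldr partial js F)) = 0" by (simp add: rel)
  from partials_relation_trivial[OF decomp assms(5) dim this js0] show "c js0 = 0" .
qed (use assms in auto)

lemma two_configs_of_decomps:
  assumes "rank1_decomp n d h F l L" "rank1_decomp n d h F l' L'"
    and d: "d = 2 * s + 1" and "n \<ge> 2" "s \<ge> 1" "h \<ge> 3" and card: "Suc (card (words n s)) = h"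
    and dim: "proj_dim (H_partial n s F) = int (card (words n s)) - 1"
    and disj: "H_partial n s F \<inter> veronese n (d - s) = {}"
  shows "two_configs n s h (\<lambda>i. coord (L i)) (\<lambda>i. coord (L' i)) l l'"
proof -
  have "point_config n s h (\<lambda>i. coord (L i))" "point_config n s h (\<lambda>i. coord (L' i))"
    using assms by (auto intro!: point_config_of_decomp[where d = d])
  moreover have "two_configs_axioms n s h (\<lambda>i. coord (L i)) (\<lambda>i. coord (L' i)) l l'"
  proof
    show "l' i \<noteq> 0" if "i < h" for i using assms(2) that by (simp add: rank1_decomp_def)
    show "(\<Sum>i<h. l i * g (coord (L i))) = (\<Sum>i<h. l' i * g (coord (L' i)))"
      if "g \<in> hform n (2 * s + 1)" for g
      using decomp_sum_eq[OF assms(1,2)] that d by simp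
  qed
  ultimately show ?thesis by (rule two_configs.intro)
qed

theorem theorem3p8:
  fixes n d h s :: nat and F :: mpoly
  assumes "F \<in> forms n d"
    and "\<exists>l L. rank1_decomp n d h F l L"
    and "(n, d, h, s) \<in> {(1, 2 * k - 1, k, k - 2) | k. k \<ge> 2} \<union> {(2, 5, 7, 2), (3, 3, 5, 1)}"
    and "proj_dim (H_partial n s F) = int ((n + s) choose n) - 1"
    and "H_partial n s F \<inter> veronese n (d - s) = {}"
  shows "identifiable n d h F"
proof -
  have "same_decomp d h l L l' L'"
    if D: "rank1_decomp n d h F l L" "rank1_decomp n d h F l' L'" for l L l' L'
  proof -
    consider "n = 1" "d = 2 * h - 1" "h \<ge> 2" | "n = 2" "d = 5" "h = 7" "s = 2" | "n = 3" "d = 3" "h = 5" "s = 1"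
      using assms(3) by auto
    then show ?thesis
    proof cases
      case 1
      show ?thesis
        by (rule same_decomp_if_proportional[OF D])
          (use 1 D binary_form_points[of h F l L l' L'] in auto)
    next
      case 2
      have card: "card (words 2 2) = 6" unfolding card_words by code_simp
      \<comment> \<open>This matches the binomial coefficient in the dimension hypothesis with
        \<open>card (words 2 2)\<close>.\<close>
      have "(2 + 2) choose 2 = (6::nat)" by code_simp
      then have "two_configs 2 2 7 (\<lambda>i. coord (L i)) (\<lambda>i. coord (L' i)) l l'"
        using assms(4,5) D 2 card by (intro two_configs_of_decomps[where d = d and F = F]) simp_all
      then show ?thesis
        using plane_quintic_configs 2 by (intro same_decomp_if_proportional[OF D]) auto
    next
      case 3
      have card: "card (words 3 1) = 4" unfolding card_words by code_simp
      have "(3 + 1) choose 3 = (4::nat)" by code_simp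
      then have "two_configs 3 1 5 (\<lambda>i. coord (L i)) (\<lambda>i. coord (L' i)) l l'"
        using assms(4,5) D 3 card by (intro two_configs_of_decomps[where d = d and F = F]) simp_all
      then show ?thesis
        using cubic_surface_configs 3 by (intro same_decomp_if_proportional[OF D]) auto
    qed
  qed
  with assms(2) show ?thesis by (auto simp: identifiable_def)
qed

end
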